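(* Let $K\subset\mathbb{E}^2$ be a convex body and let $0<W<w(K)$. Then, among all finite families of planks $P_1,\ldots,P_n$ in $\mathbb{E}^2$ whose total width $\sum_{i=1}^n w(P_i)$ is at most $W$, the maximum of $$\mathrm{vol}_2\Bigl(K\cap\bigcup_{i=1}^n P_i\Bigr)$$ is attained by a single plank of width $W$. That is, there exists a plank $P$ of width $W$ such that $\mathrm{vol}_2\bigl(K\cap\bigcup_{i=1}^n P_i\bigr)\le \mathrm{vol}_2(K\cap P)$ for every finite family of planks $P_1,\ldots,P_n$ with $\sum_{i=1}^n w(P_i)\le W$.
   Context: $\mathbb{E}^2$ is the Euclidean plane and $\mathrm{vol}_2$ is area (Lebesgue measure). A convex body is a compact convex set with nonempty interior. A plank of width $w>0$ in $\mathbb{E}^2$ is the closed (or open) set of points lying between two parallel lines at distance $w$ from each other; $w(P)$ denotes the width of a plank $P$. For a convex body $K$, $w(K)$ denotes its (minimal) width, i.e. the width of a thinnest plank containing $K$. *)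

theory Defs
  imports "HOL-Analysis.Analysis"
begin

definition convex_body :: "(real^2) set \<Rightarrow> bool" where
  "convex_body K \<longleftrightarrow> compact K \<and> convex K \<and> interior K \<noteq> {}"

text \<open>The planks bounded by the parallel lines \<open>u \<bullet> x = a\<close> and \<open>u \<bullet> x = a + w\<close>; since
  \<open>u\<close> is a unit vector, these lines are at distance \<open>w\<close>.\<close>

definition closed_plank :: "real^2 \<Rightarrow> real \<Rightarrow> real \<Rightarrow> (real^2) set" where
  "closed_plank u a w = {x. a \<le> u \<bullet> x \<and> u \<bullet> x \<le> a + w}"

definition open_plank :: "real^2 \<Rightarrow> real \<Rightarrow> real \<Rightarrow> (real^2) set" where
  "open_plank u a w = {x. a < u \<bullet> x \<and> u \<bullet> x < a + w}"

text \<open>The set \<open>P\<close> is a plank and \<open>w(P) = w\<close>. The width of a plank is determined by the set, so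
  the relation is functional in its second argument.\<close>

definition plank_of_width :: "(real^2) set \<Rightarrow> real \<Rightarrow> bool" where
  "plank_of_width P w \<longleftrightarrow> w > 0 \<and>
     (\<exists>u a. norm u = 1 \<and> (P = closed_plank u a w \<or> P = open_plank u a w))"

text \<open>For a convex body the infimum is over a nonempty set bounded below by \<open>0\<close>, and it is
  attained by a closed plank.\<close>

definition min_width :: "(real^2) set \<Rightarrow> real" where
  "min_width K = Inf {w. \<exists>P. plank_of_width P w \<and> K \<subseteq> P}"

end

theory Submission
  imports Defs
begin

text \<open>
  For a vector \<open>v\<close>, let \<open>A v\<close> be the area of \<open>K \<inter> (K + v)\<close>. Everything rests on comparing what a
  family of planks leaves uncovered in \<open>K\<close> with the values of \<open>A\<close> on the circle \<open>norm v = W\<close>.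

  Lower bound. Let planks have unit normals \<open>u\<^sub>i\<close> and widths \<open>w\<^sub>i\<close>, and let \<open>D\<close> be the set of points
  \<open>x\<close> all of whose translates \<open>x + (\<Sum>i\<in>S. w\<^sub>i u\<^sub>i)\<close>, for \<open>S \<subseteq> I\<close>, lie in \<open>K\<close>. Bang's solution of the
  plank problem chooses for each \<open>x\<close> a set \<open>S\<close> that maximises a function quadratic in the translation,
  and shows that the translate of \<open>x\<close> avoids all planks. As a function of \<open>x\<close> that maximum is a
  maximum of affine functions, hence convex, and the chosen translation is its gradient. Since
  gradients of convex functions are monotone, the map from \<open>x\<close> to its uncovered translate is
  injective, and it preserves area because it is piecewise a translation. So the uncovered part of
  \<open>K\<close> has at least the area of \<open>D\<close> (\<open>bang_translates_area\<close>). If the widths add up to \<open>W\<close>, convexity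
  of \<open>K\<close> puts the convex combination with weights \<open>w\<^sub>i / W\<close> of the sets \<open>K \<inter> (K - W u\<^sub>i)\<close> into \<open>D\<close>, and
  by the Brunn-Minkowski inequality, in the weak form that area is quasiconcave under Minkowski
  combination (\<open>area_quasiconcave\<close>), the area of \<open>D\<close> is at least the minimum of \<open>A\<close> on the circle.

  A plank that attains the bound. Let \<open>v\<close> minimise \<open>A\<close> on the circle; since \<open>W\<close> is less than the width
  of \<open>K\<close>, the set \<open>K \<inter> (K + v)\<close> has interior points. Let \<open>p\<close> and \<open>q\<close> be points of this set that are
  extreme in the directions orthogonal to \<open>v\<close>. Above the line \<open>pq\<close> (in direction \<open>v\<close>), \<open>K\<close> is contained
  in \<open>K + v\<close>, and below it \<open>K + v\<close> is contained in \<open>K\<close> (\<open>chord_line_above\<close>, \<open>chord_line_below\<close>).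
  Consequently \<open>A (v + h) \<le> A v\<close> for all \<open>h\<close> parallel to the line. If the line were not orthogonal to
  \<open>v\<close>, some such \<open>v + h\<close> would lie strictly inside the circle; as \<open>A\<close> strictly decreases along rays,
  \<open>A\<close> would be smaller than \<open>A v\<close> at the point of the circle on the ray through \<open>v + h\<close>. So the line is
  orthogonal to \<open>v\<close>, and the plank between it and its translate by \<open>- v\<close> has width \<open>W\<close>. The part of \<open>K\<close>
  above this plank and the translate by \<open>v\<close> of the part below it are disjoint subsets of
  \<open>K \<inter> (K + v)\<close>, so this plank leaves at most the area \<open>A v\<close> uncovered.
\<close>

section \<open>Bang's translations preserve area\<close>

text \<open>
  The functions \<open>x \<mapsto> v l \<bullet> x - c l\<close> have a convex maximum, and \<open>v k\<close> is a subgradient at \<open>x\<close> of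
  that maximum if the index \<open>k\<close> attains it. Moving every point by a subgradient is injective, because
  subgradients of convex functions are monotone, and it translates each of finitely many pieces of \<open>D\<close>.
\<close>

lemma measure_le_of_convex_piecewise_translation:
  fixes v :: "nat \<Rightarrow> 'a::euclidean_space" and c :: "nat \<Rightarrow> real"
  assumes D: "D \<in> lmeasurable" and T: "T \<in> lmeasurable" and n: "0 < n"
    and step: "\<And>x k. x \<in> D \<Longrightarrow> k < n \<Longrightarrow>
      (\<And>l. l < n \<Longrightarrow> v l \<bullet> x - c l \<le> v k \<bullet> x - c k) \<Longrightarrow> x + v k \<in> T"
  shows "measure lebesgue D \<le> measure lebesgue T"
proof -
  \<comment> \<open>The sets \<open>E k\<close> overlap where the maximum is attained more than once; \<open>G k\<close> resolves ties in favour
    of the least index, so that the pieces are disjoint.\<close>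
  define E where "E k = {x. \<forall>l<n. v l \<bullet> x - c l \<le> v k \<bullet> x - c k}" for k
  define G where "G k = D \<inter> (E k - (\<Union>j<k. E j))" for k
  define H where "H k = (+) (v k) ` G k" for k
  have "E k = (\<Inter>l\<in>{..<n}. {x. (v l - v k) \<bullet> x \<le> c l - c k})" for k
    by (auto simp: E_def inner_diff_left algebra_simps)
  then have "closed (E k)" for k
    by (auto intro!: closed_INT closed_halfspace_le)
  then have E: "E k \<in> sets lebesgue" for k
    by (simp add: borel_closed)
  have G: "G k \<in> lmeasurable" for k
    unfolding G_def using D E by (intro fmeasurable_Int_fmeasurable sets.Diff sets.finite_UN) auto
  have H: "H k \<in> lmeasurable" "measure lebesgue (H k) = measure lebesgue (G k)" for k
    unfolding H_def using G by (auto simp: measurable_translation measure_translation)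
  have D_eq: "D = (\<Union>k<n. G k)"
  proof
    show "D \<subseteq> (\<Union>k<n. G k)"
    proof
      fix x assume x: "x \<in> D"
      let ?S = "(\<lambda>l. v l \<bullet> x - c l) ` {..<n}"
      have "Max ?S \<in> ?S"
        using n by (intro Max_in) auto
      then obtain k where "k < n" "v k \<bullet> x - c k = Max ?S"
        by force
      then have k: "k < n \<and> x \<in> E k"
        by (auto simp: E_def)
      define m where "m = (LEAST k. k < n \<and> x \<in> E k)"
      have m: "m < n \<and> x \<in> E m"
        unfolding m_def by (rule LeastI) (rule k)
      have "x \<notin> E j" if "j < m" for j
        using not_less_Least[of j "\<lambda>k. k < n \<and> x \<in> E k"] that m by (auto simp: m_def)
      then show "x \<in> (\<Union>k<n. G k)"
        using m x by (auto simp: G_def)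
    qed
  qed (auto simp: G_def)
  have disj_G: "disjoint_family_on G {..<n}"
    unfolding disjoint_family_on_def G_def
  proof (intro ballI impI)
    fix i j :: nat assume "i \<noteq> j"
    then consider "i < j" | "j < i" by linarith
    then show "D \<inter> (E i - \<Union> (E ` {..<i})) \<inter> (D \<inter> (E j - \<Union> (E ` {..<j}))) = {}"
      by cases auto
  qed
  have disj_H: "disjoint_family_on H {..<n}"
    unfolding disjoint_family_on_def
  proof (intro ballI impI, rule ccontr)
    fix i j assume ij: "i \<in> {..<n}" "j \<in> {..<n}" "i \<noteq> j" and "H i \<inter> H j \<noteq> {}"
    then obtain x y where xy: "x \<in> G i" "y \<in> G j" "v i + x = v j + y"
      by (auto simp: H_def)
    have "v j \<bullet> x - c j \<le> v i \<bullet> x - c i" "v i \<bullet> y - c i \<le> v j \<bullet> y - c j"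
      using xy ij by (auto simp: G_def E_def)
    \<comment> \<open>Gradients of a convex function are monotone, so the two translations
      cannot bring \<open>x\<close> and \<open>y\<close> together.\<close>
    then have "0 \<le> (v i - v j) \<bullet> (x - y)"
      by (simp add: algebra_simps)
    moreover have "v i - v j = - (x - y)"
      using xy(3) by (simp add: algebra_simps add_eq_0_iff)
    ultimately have "x = y"
      by (metis inner_minus_left neg_0_le_iff_le inner_gt_zero_iff linorder_not_le right_minus_eq)
    then show False
      using disj_G xy ij unfolding disjoint_family_on_def by blast
  qed
  have finite_area: "emeasure lebesgue S \<noteq> \<infinity>" if "S \<in> lmeasurable" for S :: "'a set"
    unfolding infinity_ennreal_def by (rule fmeasurableD2[OF that])
  have "measure lebesgue D = (\<Sum>k<n. measure lebesgue (G k))"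
    unfolding D_eq using G disj_G
    by (intro measure_finite_Union finite_area fmeasurableD) auto
  also have "\<dots> = (\<Sum>k<n. measure lebesgue (H k))"
    by (simp add: H)
  also have "\<dots> = measure lebesgue (\<Union>k<n. H k)"
    using H disj_H
    by (intro measure_finite_Union[symmetric] finite_area) auto
  also have "\<dots> \<le> measure lebesgue T"
  proof (rule measure_mono_fmeasurable)
    show "(\<Union>k<n. H k) \<subseteq> T"
    proof clarify
      fix k z assume "k < n" "z \<in> H k"
      then obtain x where "x \<in> D" "\<forall>l<n. v l \<bullet> x - c l \<le> v k \<bullet> x - c k" "z = x + v k"
        by (auto simp: H_def G_def E_def add.commute)
      then show "z \<in> T"
        using step \<open>k < n\<close> by simp
    qed
    show "(\<Union>k<n. H k) \<in> sets lebesgue"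
      using H by (intro sets.finite_UN) auto
  qed (rule T)
  finally show ?thesis .
qed

text \<open>
  Bang's choice of the translation. The constants \<open>C S\<close> below are such that exchanging \<open>S\<close> with
  \<open>insert i S\<close> or \<open>S - {i}\<close> does not increase \<open>V S \<bullet> x - C S\<close> exactly if \<open>x + V S\<close> lies on or beyond
  the boundary hyperplane of the \<open>i\<close>-th plank, on its far side if \<open>i \<in> S\<close> and on its near side if \<open>i \<notin> S\<close>.
\<close>

lemma bang_translates_area:
  fixes u :: "'i \<Rightarrow> 'a::euclidean_space" and w b :: "'i \<Rightarrow> real"
  assumes I: "finite I" and u: "\<And>i. i \<in> I \<Longrightarrow> norm (u i) = 1" and w: "\<And>i. i \<in> I \<Longrightarrow> 0 < w i"
    and K: "compact K"
    and D: "D \<in> lmeasurable" "\<And>x S. x \<in> D \<Longrightarrow> S \<subseteq> I \<Longrightarrow> x + (\<Sum>i\<in>S. w i *\<^sub>R u i) \<in> K"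
  shows "measure lebesgue D
    \<le> measure lebesgue (K - (\<Union>i\<in>I. {x. b i < u i \<bullet> x \<and> u i \<bullet> x < b i + w i}))"
    (is "_ \<le> measure lebesgue (K - (\<Union>i\<in>I. ?P i))")
proof -
  define V where "V S = (\<Sum>i\<in>S. w i *\<^sub>R u i)" for S
  define C where "C S = (\<Sum>i\<in>S. w i * (b i + w i / 2)) - (norm (V S))\<^sup>2 / 2" for S
  obtain s where s: "bij_betw s {..<card (Pow I)} (Pow I)"
    using ex_bij_betw_nat_finite[of "Pow I"] I by (auto simp: lessThan_atLeast0)
  show ?thesis
  proof (rule measure_le_of_convex_piecewise_translation[where v = "V \<circ> s" and c = "C \<circ> s"
        and n = "card (Pow I)"])
    have "open (?P i)" for i
      using open_Int[OF open_halfspace_gt[of "b i" "u i"] open_halfspace_lt[of "u i" "b i + w i"]]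
      by (simp add: Int_def)
    then show "K - (\<Union>i\<in>I. ?P i) \<in> lmeasurable"
      using K by (intro lmeasurable_compact compact_diff open_UN) auto
    show "0 < card (Pow I)"
      using I by (simp add: card_Pow)
    fix x k
    assume x: "x \<in> D" and k: "k < card (Pow I)"
      and best: "\<And>l. l < card (Pow I) \<Longrightarrow> (V \<circ> s) l \<bullet> x - (C \<circ> s) l \<le> (V \<circ> s) k \<bullet> x - (C \<circ> s) k"
    define S where "S = s k"
    have max: "V T \<bullet> x - C T \<le> V S \<bullet> x - C S" if "T \<subseteq> I" for T
    proof -
      have "T \<in> s ` {..<card (Pow I)}"
        using s that by (simp add: bij_betw_def)
      then obtain l where "l < card (Pow I)" "T = s l"
        by blast
      then show ?thesis
        using best by (simp add: S_def)
    qed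
    have S: "S \<subseteq> I"
      using bij_betwE[OF s] k by (simp add: S_def)
    have C_insert: "C (insert i T) = C T + w i * b i - w i * (V T \<bullet> u i)"
      and V_insert: "V (insert i T) = V T + w i *\<^sub>R u i"
      if "i \<in> I" "finite T" "i \<notin> T" for i T
    proof -
      show V: "V (insert i T) = V T + w i *\<^sub>R u i"
        using that by (simp add: V_def)
      have "(norm (V T + w i *\<^sub>R u i))\<^sup>2 = (norm (V T))\<^sup>2 + 2 * w i * (V T \<bullet> u i) + (w i)\<^sup>2"
        using u[OF \<open>i \<in> I\<close>]
        by (simp only: power2_norm_eq_inner inner_add_left inner_add_right inner_scaleR_left
            inner_scaleR_right norm_eq_1 inner_commute[of "u i" "V T"]) (simp add: power2_eq_square algebra_simps)
      then show "C (insert i T) = C T + w i * b i - w i * (V T \<bullet> u i)"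
        using that unfolding C_def V by (simp add: power2_eq_square field_simps)
    qed
    have "x + V S \<notin> ?P i" if i: "i \<in> I" for i
    proof (cases "i \<in> S")
      case True
      define T where "T = S - {i}"
      have T: "finite T" "i \<notin> T" and S_T: "S = insert i T"
        using S I True finite_subset by (auto simp: T_def)
      have "V T \<bullet> x - C T \<le> V S \<bullet> x - C S"
        using S S_T by (intro max) auto
      then have "0 \<le> w i * (u i \<bullet> (x + V S) - (b i + w i))"
        using u[OF i] unfolding S_T C_insert[OF i T] V_insert[OF i T]
        by (simp add: inner_add_left inner_add_right inner_commute norm_eq_1 algebra_simps)
      then show ?thesis
        using w[OF i] by (simp add: zero_le_mult_iff)
    next
      case False
      have fin: "finite S"
        using S I finite_subset by auto
      have "V (insert i S) \<bullet> x - C (insert i S) \<le> V S \<bullet> x - C S"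
        using S i by (intro max) auto
      then have "0 \<le> w i * (b i - u i \<bullet> (x + V S))"
        unfolding C_insert[OF i fin False] V_insert[OF i fin False]
        by (simp add: inner_add_left inner_add_right inner_commute algebra_simps)
      then show ?thesis
        using w[OF i] by (simp add: zero_le_mult_iff)
    qed
    moreover have "x + V S \<in> K"
      using D(2)[OF x S] by (simp add: V_def)
    ultimately show "x + (V \<circ> s) k \<in> K - (\<Union>i\<in>I. ?P i)"
      by (simp add: S_def)
  qed (rule D(1))
qed

section \<open>Quasiconcavity of planar area under Minkowski combination\<close>

lemma borel_real_convex:
  fixes S :: "real set"
  shows "convex S \<Longrightarrow> S \<in> sets borel"
  by (simp add: is_interval_convex_1 real_interval_borel_measurable)

lemma measure_real_convex:
  fixes S :: "real set"
  assumes S: "convex S" "bounded S" "S \<noteq> {}"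
  shows "measure lborel S = Sup S - Inf S"
proof (rule antisym)
  have bdd: "bdd_above S" "bdd_below S"
    using S by (auto simp: bounded_imp_bdd_above bounded_imp_bdd_below)
  then have upper: "S \<subseteq> {Inf S..Sup S}"
    by (auto intro: cInf_lower cSup_upper)
  have le: "Inf S \<le> Sup S"
    using S bdd by (intro cInf_le_cSup)
  have fm: "{Inf S..Sup S} \<in> fmeasurable lborel" "{Inf S<..<Sup S} \<in> fmeasurable lborel"
    by (auto intro!: fmeasurableI simp: le)
  have borel: "S \<in> sets lborel"
    using S by (simp add: borel_real_convex)
  have "measure lborel S \<le> measure lborel {Inf S..Sup S}"
    using upper borel fm by (intro measure_mono_fmeasurable) auto
  then show "measure lborel S \<le> Sup S - Inf S"
    using le by simp
  have "{Inf S<..<Sup S} \<subseteq> S"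
  proof
    fix z assume "z \<in> {Inf S<..<Sup S}"
    then obtain x y where "x \<in> S" "x < z" "y \<in> S" "z < y"
      using S bdd by (auto simp: cInf_less_iff less_cSup_iff)
    then show "z \<in> S"
      using S(1) mem_is_interval_1_I[of S x y z] by (auto simp: is_interval_convex_1)
  qed
  then have "measure lborel {Inf S<..<Sup S} \<le> measure lborel S"
    using fmeasurableI2[OF fm(1) upper borel] fm by (intro measure_mono_fmeasurable) auto
  then show "Sup S - Inf S \<le> measure lborel S"
    using le by simp
qed

text \<open>The one-dimensional Brunn-Minkowski inequality, for intervals.\<close>

lemma measure_real_convex_combination:
  fixes S T U :: "real set"
  assumes S: "convex S" "bounded S" "S \<noteq> {}" and T: "convex T" "bounded T" "T \<noteq> {}"
    and U: "convex U" "bounded U" and t: "0 < t" "t < 1"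
    and sub: "\<And>x y. x \<in> S \<Longrightarrow> y \<in> T \<Longrightarrow> t * x + (1 - t) * y \<in> U"
  shows "t * measure lborel S + (1 - t) * measure lborel T \<le> measure lborel U"
proof -
  have bdd: "bdd_above U" "bdd_below U"
    using U by (auto simp: bounded_imp_bdd_above bounded_imp_bdd_below)
  have ne: "U \<noteq> {}"
    using S(3) T(3) sub by blast
  have "Sup S \<le> (Sup U - (1 - t) * y) / t" if "y \<in> T" for y
    using cSup_upper[OF sub[OF _ that] bdd(1)] t S(3)
    by (intro cSup_least) (auto simp: field_simps)
  then have "Sup T \<le> (Sup U - t * Sup S) / (1 - t)"
    using t T(3) by (intro cSup_least) (auto simp: field_simps)
  then have "t * Sup S + (1 - t) * Sup T \<le> Sup U"
    using t by (simp add: field_simps)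
  moreover have "(Inf U - (1 - t) * y) / t \<le> Inf S" if "y \<in> T" for y
    using cInf_lower[OF sub[OF _ that] bdd(2)] t S(3)
    by (intro cInf_greatest) (auto simp: field_simps)
  then have "(Inf U - t * Inf S) / (1 - t) \<le> Inf T"
    using t T(3) by (intro cInf_greatest) (auto simp: field_simps)
  then have "Inf U \<le> t * Inf S + (1 - t) * Inf T"
    using t by (simp add: field_simps)
  ultimately show ?thesis
    using S T U ne by (simp add: measure_real_convex algebra_simps)
qed

definition chord :: "(real \<times> real) set \<Rightarrow> real \<Rightarrow> real" where
  "chord A x = measure lborel (Pair x -` A)"

lemma
  fixes A :: "(real \<times> real) set"
  assumes "convex A" "bounded A"
  shows convex_vertical_section: "convex (Pair x -` A)"
    and bounded_vertical_section: "bounded (Pair x -` A)"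
proof -
  show "convex (Pair x -` A)"
  proof (rule convexI)
    fix y z and u v :: real
    assume "y \<in> Pair x -` A" "z \<in> Pair x -` A" "0 \<le> u" "0 \<le> v" "u + v = 1"
    then show "u *\<^sub>R y + v *\<^sub>R z \<in> Pair x -` A"
      using convexD[OF assms(1), of "(x, y)" "(x, z)" u v]
      by (simp flip: distrib_right)
  qed
  have "Pair x -` A \<subseteq> snd ` A"
    by force
  then show "bounded (Pair x -` A)"
    using assms(2) bounded_snd bounded_subset by blast
qed

text \<open>
  A Minkowski combination of planar sets contains the corresponding combinations of their vertical
  sections. The sections have to be nonempty, which is what the two positivity assumptions provide.
\<close>

lemma chord_combination:
  assumes A: "convex A" "bounded A" and B: "convex B" "bounded B" and C: "convex C" "bounded C"
    and t: "0 < t" "t < 1"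
    and sub: "\<And>p q. p \<in> A \<Longrightarrow> q \<in> B \<Longrightarrow> t *\<^sub>R p + (1 - t) *\<^sub>R q \<in> C"
    and pos: "0 < chord A x" "0 < chord B y"
  shows "t * chord A x + (1 - t) * chord B y \<le> chord C (t * x + (1 - t) * y)"
  unfolding chord_def
proof (rule measure_real_convex_combination)
  show "Pair x -` A \<noteq> {}" "Pair y -` B \<noteq> {}"
    using pos by (auto simp: chord_def)
  fix a b assume "a \<in> Pair x -` A" "b \<in> Pair y -` B"
  then show "t * a + (1 - t) * b \<in> Pair (t * x + (1 - t) * y) -` C"
    using sub[of "(x, a)" "(y, b)"] by simp
qed (use A B C t in \<open>auto intro: convex_vertical_section bounded_vertical_section\<close>)

lemma convex_chord_superlevel:
  assumes A: "convex A" "bounded A" and "0 \<le> r"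
  shows "convex {x. r < chord A x}"
proof (rule convexI)
  fix x y u v :: real
  assume xy: "x \<in> {x. r < chord A x}" "y \<in> {x. r < chord A x}" and uv: "0 \<le> u" "0 \<le> v" "u + v = 1"
  show "u *\<^sub>R x + v *\<^sub>R y \<in> {x. r < chord A x}"
  proof (cases "u = 0 \<or> u = 1")
    case True
    then show ?thesis using xy uv by auto
  next
    case False
    with uv have u: "0 < u" "u < 1" and v: "v = 1 - u" by auto
    have "u * chord A x + (1 - u) * chord A y \<le> chord A (u * x + (1 - u) * y)"
      using A u xy \<open>0 \<le> r\<close> by (intro chord_combination) (auto intro: convexD)
    moreover have "u * r + (1 - u) * r < u * chord A x + (1 - u) * chord A y"
      using u xy by (intro add_strict_mono mult_strict_left_mono) auto
    ultimately show ?thesis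
      by (simp add: v algebra_simps)
  qed
qed

lemma bounded_chord_superlevel:
  assumes "bounded A" and "0 \<le> r"
  shows "bounded {x. r < chord A x}"
proof -
  have "{x. r < chord A x} \<subseteq> fst ` A"
  proof clarify
    fix x assume "r < chord A x"
    then have "Pair x -` A \<noteq> {}"
      using \<open>0 \<le> r\<close> by (auto simp: chord_def)
    then show "x \<in> fst ` A" by force
  qed
  then show ?thesis
    using assms(1) bounded_fst bounded_subset by blast
qed

lemma chord_bounded_above:
  assumes "convex A" "bounded A"
  shows "bdd_above (range (chord A))"
proof -
  obtain R where R: "\<And>p. p \<in> A \<Longrightarrow> norm p \<le> R"
    using assms(2) bounded_iff by blast
  have "chord A x \<le> 2 * max R 0" for x
  proof -
    have "Pair x -` A \<subseteq> {- max R 0..max R 0}"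
    proof
      fix y assume "y \<in> Pair x -` A"
      then have "\<bar>y\<bar> \<le> R"
        using R[of "(x, y)"] norm_snd_le[where x = x and y = y] by simp
      then show "y \<in> {- max R 0..max R 0}" by auto
    qed
    then have "chord A x \<le> measure lborel {- max R 0..max R 0}"
      unfolding chord_def
      using convex_vertical_section[OF assms, of x]
      by (intro measure_mono_fmeasurable fmeasurableI) (auto simp: borel_real_convex)
    then show ?thesis by simp
  qed
  then show ?thesis by (intro bdd_aboveI2)
qed

lemma borel_measurable_chord [measurable]:
  assumes "A \<in> sets borel"
  shows "chord A \<in> borel_measurable borel"
proof -
  have "(\<lambda>x. emeasure lborel (Pair x -` A)) \<in> borel_measurable lborel"
    using assms lborel.measurable_emeasure_Pair[of A lborel] by (simp add: lborel_prod)
  then show ?thesis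
    unfolding chord_def measure_def by simp
qed

lemma emeasure_eq_nn_integral_chord:
  assumes "A \<in> sets borel" "convex A" "bounded A"
  shows "emeasure lborel A = (\<integral>\<^sup>+x. ennreal (chord A x) \<partial>lborel)"
proof -
  have "emeasure lborel (Pair x -` A) = ennreal (chord A x)" for x
    unfolding chord_def
    using emeasure_bounded_finite[OF bounded_vertical_section[OF assms(2,3), of x]]
    by (intro emeasure_eq_ennreal_measure) simp
  moreover have "A \<in> sets (lborel \<Otimes>\<^sub>M lborel)"
    unfolding lborel_prod using assms(1) by simp
  ultimately show ?thesis
    using lborel.emeasure_pair_measure_alt[of A lborel] unfolding lborel_prod by simp
qed

lemma nn_integral_layer_cake:
  fixes f :: "real \<Rightarrow> real"
  assumes [measurable]: "f \<in> borel_measurable borel" and "\<And>x. 0 \<le> f x" and M: "0 < M"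
  shows "(\<integral>\<^sup>+x. ennreal (f x) \<partial>lborel)
    = ennreal M * (\<integral>\<^sup>+s. indicator {0<..} s * emeasure lborel {x. s * M < f x} \<partial>lborel)"
proof -
  have "(\<integral>\<^sup>+x. ennreal (f x) \<partial>lborel)
    = (\<integral>\<^sup>+x. \<integral>\<^sup>+r. indicator {(x, r). 0 < r \<and> r < f x} (x, r) \<partial>lborel \<partial>lborel)"
  proof (rule nn_integral_cong)
    fix x :: real
    have "(\<integral>\<^sup>+r. indicator {(x, r). 0 < r \<and> r < f x} (x, r) \<partial>lborel)
      = (\<integral>\<^sup>+r. indicator {0<..<f x} r \<partial>lborel)"
      by (intro nn_integral_cong) (auto simp: indicator_def)
    then show "ennreal (f x) = (\<integral>\<^sup>+r. indicator {(x, r). 0 < r \<and> r < f x} (x, r) \<partial>lborel)"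
      using assms(2)[of x] by simp
  qed
  also have "\<dots> = (\<integral>\<^sup>+r. \<integral>\<^sup>+x. indicator {(x, r). 0 < r \<and> r < f x} (x, r) \<partial>lborel \<partial>lborel)"
    by (rule lborel_pair.Fubini'[symmetric]) measurable
  also have "\<dots> = (\<integral>\<^sup>+r. indicator {0<..} r * emeasure lborel {x. r < f x} \<partial>lborel)"
  proof (rule nn_integral_cong)
    fix r :: real
    have "(\<integral>\<^sup>+x. indicator {(x, r). 0 < r \<and> r < f x} (x, r) \<partial>lborel)
      = (\<integral>\<^sup>+x. indicator {0<..} r * indicator {x. r < f x} x \<partial>lborel)"
      by (intro nn_integral_cong) (auto simp: indicator_def)
    then show "(\<integral>\<^sup>+x. indicator {(x, r). 0 < r \<and> r < f x} (x, r) \<partial>lborel)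
      = indicator {0<..} r * emeasure lborel {x. r < f x}"
      by (simp add: nn_integral_cmult)
  qed
  also have "\<dots> = ennreal M * (\<integral>\<^sup>+s. indicator {0<..} (0 + M * s)
      * emeasure lborel {x. 0 + M * s < f x} \<partial>lborel)"
  proof (subst nn_integral_real_affine[where c = M and t = 0])
    have "{p \<in> space (borel \<Otimes>\<^sub>M borel). fst p < f (snd p)} \<in> sets (borel \<Otimes>\<^sub>M borel)"
      by measurable
    then have "(\<lambda>r. emeasure lborel (Pair r -` {p. fst p < f (snd p)})) \<in> borel_measurable borel"
      using lborel.measurable_emeasure_Pair[of "{p. fst p < f (snd p)}" borel]
      by (simp add: space_pair_measure cong: measurable_cong_sets sets_pair_measure_cong)
    then show "(\<lambda>r. indicator {0<..} r * emeasure lborel {x. r < f x}) \<in> borel_measurable borel"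
      by (simp add: vimage_def)
  qed (use M in auto)
  also have "(\<lambda>s. indicator {0<..} (0 + M * s) * emeasure lborel {x. 0 + M * s < f x})
    = (\<lambda>s. indicator {0<..} s * emeasure lborel {x. s * M < f x})"
    using M by (auto simp: indicator_def zero_less_mult_iff mult.commute fun_eq_iff)
  finally show ?thesis .
qed

text \<open>
  The layer cake formula for the chord lengths of \<open>A\<close>, with levels measured as fractions of the
  supremum \<open>M\<close> of these lengths. Then every level below \<open>1\<close> is nonempty, whatever the set \<open>A\<close>; this is what makes
  the levels of two sets comparable in the next lemma.
\<close>

lemma chord_layers:
  assumes A: "A \<in> sets borel" "convex A" "bounded A" and m: "0 < m" "ennreal m \<le> emeasure lborel A"
  obtains M where "0 < M" "\<And>s. 0 \<le> s \<Longrightarrow> s < 1 \<Longrightarrow> \<exists>x. s * M < chord A x"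
    "ennreal (m / M) \<le> (\<integral>\<^sup>+s. indicator {0<..<1} s * emeasure lborel {x. s * M < chord A x} \<partial>lborel)"
proof
  define M where "M = Sup (range (chord A))"
  note bdd = chord_bounded_above[OF A(2,3)]
  have M: "chord A x \<le> M" for x
    unfolding M_def by (intro cSup_upper bdd) auto
  have nonneg: "0 \<le> chord A x" for x
    by (simp add: chord_def)
  show M_pos: "0 < M"
  proof (rule ccontr)
    assume "\<not> 0 < M"
    then have "chord A x = 0" for x
      using M[of x] nonneg[of x] by linarith
    then have "emeasure lborel A = 0"
      using emeasure_eq_nn_integral_chord[OF A] by simp
    then show False
      using m by (simp add: ennreal_eq_0_iff)
  qed
  show "\<exists>x. s * M < chord A x" if "0 \<le> s" "s < 1" for s
  proof -
    have "s * M < Sup (range (chord A))"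
      using that M_pos unfolding M_def[symmetric] by simp
    then show ?thesis
      using bdd by (subst (asm) less_cSup_iff) auto
  qed
  let ?I = "\<integral>\<^sup>+s. indicator {0<..<1} s * emeasure lborel {x. s * M < chord A x} \<partial>lborel"
  have empty: "{x. s * M < chord A x} = {}" if "1 \<le> s" for s
  proof -
    have "M \<le> s * M"
      using that M_pos by simp
    then show ?thesis
      using M by (auto simp: not_less intro: order_trans)
  qed
  have "emeasure lborel A = ennreal M
      * (\<integral>\<^sup>+s. indicator {0<..} s * emeasure lborel {x. s * M < chord A x} \<partial>lborel)"
    unfolding emeasure_eq_nn_integral_chord[OF A]
    using A(1) M_pos nonneg by (intro nn_integral_layer_cake) auto
  also have "(\<lambda>s. indicator {0<..} s * emeasure lborel {x. s * M < chord A x})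
      = (\<lambda>s. indicator {0<..<1} s * emeasure lborel {x. s * M < chord A x})"
    using empty by (auto simp: indicator_def fun_eq_iff)
  finally have "ennreal m \<le> ennreal M * ?I"
    using m by simp
  then have "ennreal (1 / M) * ennreal m \<le> ennreal (1 / M) * (ennreal M * ?I)"
    by (rule mult_left_mono) simp
  also have "\<dots> = ?I"
    using M_pos by (simp flip: mult.assoc ennreal_mult)
  finally show "ennreal (m / M) \<le> ?I"
    using M_pos m by (simp flip: ennreal_mult)
qed

text \<open>
  At each relative level \<open>s\<close> the superlevel sets of the chord lengths of \<open>A\<close>, \<open>B\<close> and \<open>C\<close> are intervals
  that satisfy the one-dimensional inequality, provided that chords of \<open>C\<close> are measured relative to
  \<open>L = t M + (1 - t) N\<close>, where \<open>M\<close> and \<open>N\<close> are the suprema of the chord lengths of \<open>A\<close> and \<open>B\<close>. Integration over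
  \<open>s\<close> bounds the area of \<open>C\<close> below by \<open>m L (t / M + (1 - t) / N)\<close>, and
  \<open>L (t / M + (1 - t) / N) \<ge> 1\<close> by the inequality of the arithmetic and harmonic means.
\<close>

lemma area_quasiconcave_prod:
  fixes A B C :: "(real \<times> real) set"
  assumes A: "A \<in> sets borel" "convex A" "bounded A" and B: "B \<in> sets borel" "convex B" "bounded B"
    and C: "C \<in> sets borel" "convex C" "bounded C"
    and t: "0 < t" "t < 1"
    and sub: "\<And>p q. p \<in> A \<Longrightarrow> q \<in> B \<Longrightarrow> t *\<^sub>R p + (1 - t) *\<^sub>R q \<in> C"
    and m: "0 < m" "ennreal m \<le> emeasure lborel A" "ennreal m \<le> emeasure lborel B"
  shows "ennreal m \<le> emeasure lborel C"
proof -
  obtain M where M: "0 < M" "\<And>s. 0 \<le> s \<Longrightarrow> s < 1 \<Longrightarrow> \<exists>x. s * M < chord A x"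
    "ennreal (m / M) \<le> (\<integral>\<^sup>+s. indicator {0<..<1} s * emeasure lborel {x. s * M < chord A x} \<partial>lborel)"
    using chord_layers[OF A m(1,2)] by blast
  obtain N where N: "0 < N" "\<And>s. 0 \<le> s \<Longrightarrow> s < 1 \<Longrightarrow> \<exists>x. s * N < chord B x"
    "ennreal (m / N) \<le> (\<integral>\<^sup>+s. indicator {0<..<1} s * emeasure lborel {x. s * N < chord B x} \<partial>lborel)"
    using chord_layers[OF B m(1,3)] by blast
  define L where "L = t * M + (1 - t) * N"
  have L: "0 < L"
    using M(1) N(1) t by (simp add: L_def add_pos_pos)
  have fin: "emeasure lborel {x. r < chord S x} = ennreal (measure lborel {x. r < chord S x})"
    if "bounded S" "0 \<le> r" for S r
    using emeasure_bounded_finite[OF bounded_chord_superlevel[OF that]]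
    by (intro emeasure_eq_ennreal_measure) simp
  have level_meas: "(\<lambda>s. emeasure lborel {x. s * r < chord S x}) \<in> borel_measurable lborel"
    if "S \<in> sets borel" for S and r :: real
  proof -
    note [measurable] = borel_measurable_chord[OF that]
    have "{p \<in> space (borel \<Otimes>\<^sub>M borel). fst p * r < chord S (snd p)} \<in> sets (borel \<Otimes>\<^sub>M borel)"
      by measurable
    then have "(\<lambda>s. emeasure lborel (Pair s -` {p. fst p * r < chord S (snd p)})) \<in> borel_measurable borel"
      using lborel.measurable_emeasure_Pair[of "{p. fst p * r < chord S (snd p)}" borel]
      by (simp add: space_pair_measure cong: measurable_cong_sets sets_pair_measure_cong)
    then show ?thesis
      by (simp add: vimage_def)
  qed
  have level: "ennreal t * emeasure lborel {x. s * M < chord A x}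
      + ennreal (1 - t) * emeasure lborel {x. s * N < chord B x}
    \<le> emeasure lborel {x. s * L < chord C x}" if s: "0 < s" "s < 1" for s
  proof -
    have nonneg: "0 \<le> s * M" "0 \<le> s * N" "0 \<le> s * L"
      using s M N L by auto
    have "t * measure lborel {x. s * M < chord A x} + (1 - t) * measure lborel {x. s * N < chord B x}
        \<le> measure lborel {x. s * L < chord C x}"
    proof (rule measure_real_convex_combination)
      fix x y assume xy: "x \<in> {x. s * M < chord A x}" "y \<in> {x. s * N < chord B x}"
      then have pos: "0 < chord A x" "0 < chord B y"
        using nonneg by auto
      have "s * L = t * (s * M) + (1 - t) * (s * N)"
        by (simp add: L_def algebra_simps)
      also have "\<dots> < t * chord A x + (1 - t) * chord B y"
        using xy t by (intro add_strict_mono mult_strict_left_mono) auto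
      also have "\<dots> \<le> chord C (t * x + (1 - t) * y)"
        using A B C t sub pos by (intro chord_combination) auto
      finally show "t * x + (1 - t) * y \<in> {x. s * L < chord C x}"
        by simp
    qed (use A B C t s M(2)[of s] N(2)[of s] nonneg in
        \<open>auto intro: convex_chord_superlevel bounded_chord_superlevel\<close>)
    then show ?thesis
      using A B C t nonneg by (simp add: fin flip: ennreal_mult ennreal_plus)
  qed
  have "1 \<le> L * (t / M + (1 - t) / N)"
  proof -
    have "L * (t / M + (1 - t) / N) = 1 + t * (1 - t) * (M - N)\<^sup>2 / (M * N)"
      using M(1) N(1) by (simp add: L_def field_simps power2_eq_square)
    moreover have "0 \<le> t * (1 - t) * (M - N)\<^sup>2 / (M * N)"
      using M(1) N(1) t by simp
    ultimately show ?thesis by linarith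
  qed
  then have "m \<le> m * (L * (t / M + (1 - t) / N))"
    using m(1) by simp
  then have "ennreal m \<le> ennreal (L * (t * (m / M) + (1 - t) * (m / N)))"
    by (intro ennreal_leI) (simp add: field_simps)
  also have "\<dots> = ennreal L * (ennreal t * ennreal (m / M) + ennreal (1 - t) * ennreal (m / N))"
    using L M(1) N(1) t m(1) by (simp flip: ennreal_mult ennreal_plus)
  also have "\<dots> \<le> ennreal L
    * (ennreal t * (\<integral>\<^sup>+s. indicator {0<..<1} s * emeasure lborel {x. s * M < chord A x} \<partial>lborel)
     + ennreal (1 - t) * (\<integral>\<^sup>+s. indicator {0<..<1} s * emeasure lborel {x. s * N < chord B x} \<partial>lborel))"
    using M(3) N(3) by (intro mult_left_mono add_mono) auto
  also have "\<dots> = ennreal L * (\<integral>\<^sup>+s. indicator {0<..<1} s * (ennreal t * emeasure lborel {x. s * M < chord A x}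
     + ennreal (1 - t) * emeasure lborel {x. s * N < chord B x}) \<partial>lborel)"
    using level_meas[OF A(1)] level_meas[OF B(1)]
    by (simp add: distrib_left mult.left_commute nn_integral_add nn_integral_cmult)
  also have "\<dots> \<le> ennreal L * (\<integral>\<^sup>+s. indicator {0<..} s * emeasure lborel {x. s * L < chord C x} \<partial>lborel)"
    using level by (intro mult_left_mono nn_integral_mono) (auto simp: indicator_def)
  also have "\<dots> = emeasure lborel C"
    unfolding emeasure_eq_nn_integral_chord[OF C]
    using C(1) L by (intro nn_integral_layer_cake[symmetric]) (auto simp: chord_def)
  finally show ?thesis .
qed

lemma lborel_real2_eq_distr:
  "lborel = distr lborel borel (\<lambda>p. vector [fst p, snd p] :: real^2)"
proof (rule lborel_eqI)
  have [measurable]: "(\<lambda>p. vector [fst p, snd p] :: real^2) \<in> borel \<rightarrow>\<^sub>M borel"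
  proof (rule borel_measurable_continuous_onI)
    have "continuous_on UNIV (\<lambda>p :: real \<times> real. (vector [fst p, snd p] :: real^2) $ i)" for i
      using exhaust_2[of i] continuous_on_fst[OF continuous_on_id, of "UNIV :: (real \<times> real) set"]
        continuous_on_snd[OF continuous_on_id, of "UNIV :: (real \<times> real) set"]
      by auto
    then have "continuous_on UNIV (\<lambda>p :: real \<times> real. \<chi> i. (vector [fst p, snd p] :: real^2) $ i)"
      by (rule continuous_on_vec_lambda)
    then show "continuous_on UNIV (\<lambda>p :: real \<times> real. vector [fst p, snd p] :: real^2)"
      by simp
  qed
  fix l u :: "real^2" assume le: "\<And>b. b \<in> Basis \<Longrightarrow> l \<bullet> b \<le> u \<bullet> b"
  have le': "l $ i \<le> u $ i" for i
    using le[of "axis i 1"] by (simp add: inner_axis)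
  have "(\<lambda>p. vector [fst p, snd p] :: real^2) -` box l u = box (l $ 1) (u $ 1) \<times> box (l $ 2) (u $ 2)"
    by (auto simp: mem_box_cart forall_2)
  moreover have "emeasure lborel (box (l $ 1) (u $ 1) \<times> box (l $ 2) (u $ 2))
      = ennreal (u $ 1 - l $ 1) * ennreal (u $ 2 - l $ 2)"
    using le' by (simp add: lborel.emeasure_pair_measure_Times flip: lborel_prod)
  moreover have "(\<Prod>b\<in>Basis. (u - l) \<bullet> b) = (\<Prod>i\<in>UNIV. (u - l) $ i)"
  proof -
    have B: "(Basis :: (real^2) set) = (\<lambda>i. axis i 1) ` UNIV"
      by (auto simp: Basis_vec_def)
    have "inj (\<lambda>i. axis i 1 :: real^2)"
      by (simp add: inj_on_def axis_eq_axis)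
    then show ?thesis
      unfolding B by (simp add: prod.reindex inner_axis)
  qed
  ultimately show "emeasure (distr lborel borel (\<lambda>p. vector [fst p, snd p])) (box l u)
      = (\<Prod>b\<in>Basis. (u - l) \<bullet> b)"
    using le' by (simp add: emeasure_distr UNIV_2 ennreal_mult)
qed simp

lemma area_quasiconcave:
  fixes A B C :: "(real^2) set"
  assumes A: "compact A" "convex A" and B: "compact B" "convex B" and C: "compact C" "convex C"
    and t: "0 < t" "t < 1"
    and sub: "\<And>x y. x \<in> A \<Longrightarrow> y \<in> B \<Longrightarrow> t *\<^sub>R x + (1 - t) *\<^sub>R y \<in> C"
    and m: "m \<le> measure lebesgue A" "m \<le> measure lebesgue B"
  shows "m \<le> measure lebesgue C"
proof (cases "0 < m")
  case True
  define f where "f p = (vector [fst p, snd p] :: real^2)" for p :: "real \<times> real"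
  have f: "linear f"
    by (rule linearI) (auto simp: f_def vec_eq_iff forall_2)
  have f_meas: "f \<in> borel \<rightarrow>\<^sub>M borel"
    using f by (intro borel_measurable_continuous_onI linear_continuous_on linear_conv_bounded_linear[THEN iffD1])
  have em: "emeasure lborel (f -` S) = ennreal (measure lebesgue S)" if "compact S" for S
  proof -
    have "emeasure lborel (f -` S) = emeasure (distr lborel borel f) S"
      using f_meas that by (simp add: emeasure_distr borel_compact)
    also have "\<dots> = emeasure lborel S"
      using lborel_real2_eq_distr unfolding f_def[abs_def] by simp
    also have "\<dots> = ennreal (measure lborel S)"
      using emeasure_compact_finite[OF that] by (intro emeasure_eq_ennreal_measure) simp
    finally show ?thesis
      using that by (simp add: borel_compact)
  qed
  have props: "f -` S \<in> sets borel" "convex (f -` S)" "bounded (f -` S)" if "compact S" "convex S" for S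
  proof -
    show "f -` S \<in> sets borel"
      using measurable_sets[OF f_meas borel_compact[OF that(1)]] by simp
    show "convex (f -` S)"
      using f that by (intro convex_linear_vimage)
    have "f -` S \<subseteq> (\<lambda>x. (x $ 1, x $ 2)) ` S"
      by (force simp: f_def)
    moreover have "bounded ((\<lambda>x. (x $ 1, x $ 2)) ` S)"
      using that by (intro compact_imp_bounded compact_continuous_image continuous_intros)
    ultimately show "bounded (f -` S)"
      by (rule bounded_subset[rotated])
  qed
  have "ennreal m \<le> emeasure lborel (f -` C)"
    using True m f sub
    by (intro area_quasiconcave_prod[OF props[OF A] props[OF B] props[OF C] t])
      (auto simp: em A B linear_add linear_scale ennreal_leI)
  then show ?thesis
    using em[OF C(1)] True by (simp add: ennreal_le_iff)
next
  case False
  then show ?thesis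
    using measure_nonneg[of lebesgue C] by linarith
qed

text \<open>
  The witness \<open>D\<close> is the Minkowski combination of the sets. Stating its existence together with compactness and
  convexity lets the induction add one summand at a time.
\<close>

lemma area_quasiconcave_sum:
  fixes C :: "'i \<Rightarrow> (real^2) set"
  assumes "finite I" "I \<noteq> {}" and C: "\<And>i. i \<in> I \<Longrightarrow> compact (C i)" "\<And>i. i \<in> I \<Longrightarrow> convex (C i)"
    and c: "\<And>i. i \<in> I \<Longrightarrow> 0 < c i" "(\<Sum>i\<in>I. c i) = 1"
    and m: "\<And>i. i \<in> I \<Longrightarrow> m \<le> measure lebesgue (C i)"
  shows "\<exists>D. compact D \<and> convex D \<and> m \<le> measure lebesgue D \<and>
    (\<forall>z\<in>D. \<exists>x. (\<forall>i\<in>I. x i \<in> C i) \<and> z = (\<Sum>i\<in>I. c i *\<^sub>R x i))"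
  using assms
proof (induction I arbitrary: c rule: finite_ne_induct)
  case (singleton i)
  then show ?case
    by (intro exI[of _ "C i"]) (auto intro: exI[of _ "\<lambda>_. _"])
next
  case (insert i I)
  define t where "t = c i"
  have sum: "(\<Sum>j\<in>I. c j) = 1 - t" "0 < (\<Sum>j\<in>I. c j)"
    using insert by (auto simp: t_def intro!: sum_pos)
  have t: "0 < t" "t < 1"
    using insert sum by (auto simp: t_def)
  have "\<exists>D. compact D \<and> convex D \<and> m \<le> measure lebesgue D \<and>
    (\<forall>z\<in>D. \<exists>x. (\<forall>j\<in>I. x j \<in> C j) \<and> z = (\<Sum>j\<in>I. (c j / (1 - t)) *\<^sub>R x j))"
    using insert t sum by (intro insert.IH) (auto simp flip: sum_divide_distrib)
  then obtain D where D: "compact D" "convex D" "m \<le> measure lebesgue D"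
    and D_sum: "\<And>z. z \<in> D \<Longrightarrow> \<exists>x. (\<forall>j\<in>I. x j \<in> C j) \<and> z = (\<Sum>j\<in>I. (c j / (1 - t)) *\<^sub>R x j)"
    by blast
  let ?f = "\<lambda>p. t *\<^sub>R fst p + (1 - t) *\<^sub>R snd p :: real^2"
  have lin: "linear ?f"
    by (rule linearI) (auto simp: algebra_simps)
  define E where "E = ?f ` (C i \<times> D)"
  have E: "compact E" "convex E"
    unfolding E_def using insert.prems D
    by (auto intro!: compact_continuous_image compact_Times convex_linear_image lin convex_Times continuous_intros)
  moreover have "m \<le> measure lebesgue E"
    using insert.prems D E t
    by (intro area_quasiconcave[of "C i" D E t]) (auto simp: E_def image_iff intro!: bexI)
  moreover have "\<exists>x. (\<forall>j\<in>insert i I. x j \<in> C j) \<and> z = (\<Sum>j\<in>insert i I. c j *\<^sub>R x j)" if z: "z \<in> E" for z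
  proof -
    obtain r where r: "z = ?f r" "r \<in> C i \<times> D"
      using z unfolding E_def by (rule imageE)
    define a b where "a = fst r" and "b = snd r"
    with r have ab: "a \<in> C i" "b \<in> D" "z = t *\<^sub>R a + (1 - t) *\<^sub>R b"
      by auto
    obtain x where x: "\<forall>j\<in>I. x j \<in> C j" "b = (\<Sum>j\<in>I. (c j / (1 - t)) *\<^sub>R x j)"
      using D_sum[OF ab(2)] by blast
    have "(\<Sum>j\<in>insert i I. c j *\<^sub>R (x(i := a)) j) = t *\<^sub>R a + (\<Sum>j\<in>I. c j *\<^sub>R x j)"
    proof -
      have "(\<Sum>j\<in>I. c j *\<^sub>R (x(i := a)) j) = (\<Sum>j\<in>I. c j *\<^sub>R x j)"
        using insert.hyps by (intro sum.cong refl) (metis fun_upd_other)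
      then show ?thesis
        using insert.hyps by (simp add: t_def)
    qed
    also have "(\<Sum>j\<in>I. c j *\<^sub>R x j) = (1 - t) *\<^sub>R b"
      using t by (simp add: x scaleR_sum_right)
    finally show ?thesis
      using ab x insert.hyps by (intro exI[of _ "x(i := a)"]) auto
  qed
  ultimately show ?case by blast
qed

section \<open>Intersections of a convex body with its translates\<close>

definition overlap :: "'a::euclidean_space set \<Rightarrow> 'a \<Rightarrow> 'a set" where
  "overlap K v = {x \<in> K. x - v \<in> K}"

lemma overlap_eq_Int_translation: "overlap K v = K \<inter> (+) v ` K"
  by (force simp: overlap_def image_iff algebra_simps)

lemma compact_overlap: "compact K \<Longrightarrow> compact (overlap K v)"
  unfolding overlap_eq_Int_translation
  by (intro compact_Int compact_translation)

lemma convex_overlap: "convex K \<Longrightarrow> convex (overlap K v)"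
  unfolding overlap_eq_Int_translation
  by (intro convex_Int convex_translation)

lemma overlap_antimono:
  assumes K: "convex K" and c: "0 \<le> c" "c \<le> 1"
  shows "overlap K v \<subseteq> overlap K (c *\<^sub>R v)"
proof
  fix x assume x: "x \<in> overlap K v"
  have "(1 - c) *\<^sub>R x + c *\<^sub>R (x - v) \<in> K"
    using x c K by (intro convexD) (auto simp: overlap_def)
  then show "x \<in> overlap K (c *\<^sub>R v)"
    using x by (simp add: overlap_def algebra_simps)
qed

text \<open>
  Besides \<open>K \<inter> (K + v)\<close>, the set \<open>K \<inter> (K + c v)\<close> also contains the translate of the former by
  \<open>- (1 - c) v\<close>. For strictness a ball suffices: take one close to the points of \<open>K \<inter> (K + v)\<close> that are
  lowest in direction \<open>v\<close>; the translation moves it out of \<open>K \<inter> (K + v)\<close>.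
\<close>

lemma measure_overlap_scale_less:
  fixes K :: "'a::euclidean_space set"
  assumes K: "compact K" "convex K" and int: "interior (overlap K v) \<noteq> {}"
    and v: "v \<noteq> 0" and c: "0 \<le> c" "c < 1"
  shows "measure lebesgue (overlap K v) < measure lebesgue (overlap K (c *\<^sub>R v))"
proof -
  let ?S = "overlap K v"
  have S: "compact ?S" "convex ?S"
    using K by (auto intro: compact_overlap convex_overlap)
  have "?S \<noteq> {}"
    using int interior_subset by fastforce
  then have "\<exists>x\<in>?S. \<forall>y\<in>?S. v \<bullet> x \<le> v \<bullet> y"
    using S(1) by (intro continuous_attains_inf continuous_intros)
  then obtain x where x: "x \<in> ?S" "\<And>y. y \<in> ?S \<Longrightarrow> v \<bullet> x \<le> v \<bullet> y"
    by blast
  define \<delta> where "\<delta> = (1 - c) * (v \<bullet> v)"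
  have \<delta>: "0 < \<delta>"
    using v c by (simp add: \<delta>_def)
  have "x \<in> closure (interior ?S)"
    using x(1) convex_closure_interior[OF S(2) int] closure_subset by blast
  then obtain y where y: "y \<in> interior ?S" "dist y x < \<delta> / norm v"
    using \<delta> v by (metis closure_approachable divide_pos_pos zero_less_norm_iff)
  have "v \<bullet> (y - x) \<le> norm v * dist y x"
    by (metis dist_norm norm_cauchy_schwarz)
  also have "\<dots> < \<delta>"
    using y(2) v by (simp add: field_simps)
  finally have "v \<bullet> y < v \<bullet> x + \<delta>"
    by (simp add: inner_diff_right)
  then have "y \<in> interior ?S \<inter> {z. v \<bullet> z < v \<bullet> x + \<delta>}"
    using y by simp
  then obtain r where r: "0 < r" "ball y r \<subseteq> interior ?S \<inter> {z. v \<bullet> z < v \<bullet> x + \<delta>}"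
    using open_contains_ball[of "interior ?S \<inter> {z. v \<bullet> z < v \<bullet> x + \<delta>}"] open_halfspace_lt
    by (metis open_Int open_interior)
  define B where "B = ball (y - (1 - c) *\<^sub>R v) r"
  have B: "z + (1 - c) *\<^sub>R v \<in> ?S" "v \<bullet> z < v \<bullet> x" if "z \<in> B" for z
  proof -
    have "z + (1 - c) *\<^sub>R v \<in> ball y r"
      using that by (simp add: B_def dist_norm algebra_simps)
    then have "z + (1 - c) *\<^sub>R v \<in> interior ?S" "v \<bullet> (z + (1 - c) *\<^sub>R v) < v \<bullet> x + \<delta>"
      using r(2) by auto
    then show "z + (1 - c) *\<^sub>R v \<in> ?S" "v \<bullet> z < v \<bullet> x"
      using interior_subset by (auto simp: \<delta>_def inner_add_right)
  qed
  have disj: "?S \<inter> B = {}"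
    using B(2) x(2) by fastforce
  have "B \<subseteq> overlap K (c *\<^sub>R v)"
  proof
    fix z assume "z \<in> B"
    then have z: "z + (1 - c) *\<^sub>R v \<in> K" "z + (1 - c) *\<^sub>R v - v \<in> K"
      using B(1) by (auto simp: overlap_def)
    then have "c *\<^sub>R (z + (1 - c) *\<^sub>R v) + (1 - c) *\<^sub>R (z + (1 - c) *\<^sub>R v - v) \<in> K"
      using K c by (intro convexD) auto
    then show "z \<in> overlap K (c *\<^sub>R v)"
      using z(2) by (simp add: overlap_def algebra_simps)
  qed
  then have sub: "?S \<union> B \<subseteq> overlap K (c *\<^sub>R v)"
    using overlap_antimono[OF K(2)] c by auto
  have "B \<in> lmeasurable" "0 < measure lebesgue B"
    using r(1) content_ball_pos[of r "y - (1 - c) *\<^sub>R v"] by (auto simp: B_def)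
  then have "measure lebesgue ?S < measure lebesgue (?S \<union> B)"
    using S disj by (subst measure_Un3) (auto simp: lmeasurable_compact)
  also have "\<dots> \<le> measure lebesgue (overlap K (c *\<^sub>R v))"
  proof (rule measure_mono_fmeasurable[OF sub])
    show "?S \<union> B \<in> sets lebesgue"
      using \<open>B \<in> lmeasurable\<close> lmeasurable_compact[OF S(1)] by blast
  qed (use K in \<open>simp add: lmeasurable_compact compact_overlap\<close>)
  finally show ?thesis .
qed

text \<open>
  Dominated convergence: when \<open>x - v\<close> is not on the frontier of \<open>K\<close>, whether \<open>x - w\<close> lies in \<open>K\<close> does not
  change for \<open>w\<close> near \<open>v\<close>, and the frontier of a convex set is negligible.
\<close>

lemma continuous_on_measure_overlap:
  fixes K :: "'a::euclidean_space set"
  assumes K: "compact K" "convex K"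
  shows "continuous_on S (\<lambda>v. measure lebesgue (overlap K v))"
proof (rule continuous_on_sequentiallyI)
  fix w :: "nat \<Rightarrow> 'a" and v
  assume w: "w \<longlonglongrightarrow> v"
  have overlap: "overlap K x \<in> lmeasurable" for x
    using K by (simp add: lmeasurable_compact compact_overlap)
  have "(\<lambda>n. integral\<^sup>L lebesgue (indicat_real (overlap K (w n))))
    \<longlonglongrightarrow> integral\<^sup>L lebesgue (indicat_real (overlap K v))"
  proof (rule integral_dominated_convergence[where w = "indicat_real K"])
    show "integrable lebesgue (indicat_real K)"
      using lmeasurable_compact[OF K(1)] by (simp add: lmeasurable_iff_integrable)
    show "indicat_real (overlap K v) \<in> borel_measurable lebesgue"
      "\<And>n. indicat_real (overlap K (w n)) \<in> borel_measurable lebesgue"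
      using overlap by (auto intro: borel_measurable_indicator)
    show "AE x in lebesgue. norm (indicat_real (overlap K (w n)) x) \<le> indicat_real K x" for n
      by (auto simp: indicator_def overlap_def)
    have "(+) v ` frontier K \<in> null_sets lebesgue"
      using negligible_translation[OF negligible_convex_frontier[OF K(2)]]
      by (simp add: negligible_iff_null_sets)
    then have "AE x in lebesgue. x \<notin> (+) v ` frontier K"
      by (rule AE_not_in)
    then show "AE x in lebesgue. (\<lambda>n. indicat_real (overlap K (w n)) x) \<longlonglongrightarrow> indicat_real (overlap K v) x"
    proof eventually_elim
      case (elim x)
      have lim: "(\<lambda>n. x - w n) \<longlonglongrightarrow> x - v"
        by (intro tendsto_intros w)
      have "x - v \<notin> frontier K"
        using elim by (metis add.commute diff_add_cancel image_eqI)
      then consider "x - v \<in> interior K" | "x - v \<in> - K"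
        using closure_subset by (auto simp: frontier_def)
      then have "eventually (\<lambda>n. x - w n \<in> K \<longleftrightarrow> x - v \<in> K) sequentially"
      proof cases
        case 1
        then have "eventually (\<lambda>n. x - w n \<in> interior K) sequentially"
          using topological_tendstoD[OF lim open_interior] by blast
        then show ?thesis
          by eventually_elim (use 1 interior_subset in auto)
      next
        case 2
        then have "eventually (\<lambda>n. x - w n \<in> - K) sequentially"
          using topological_tendstoD[OF lim open_Compl] compact_imp_closed[OF K(1)] by blast
        then show ?thesis
          by eventually_elim (use 2 in auto)
      qed
      then show ?case
        by (intro tendsto_eventually) (auto elim!: eventually_mono simp: indicator_def overlap_def)
    qed
  qed
  then show "(\<lambda>n. measure lebesgue (overlap K (w n))) \<longlonglongrightarrow> measure lebesgue (overlap K v)"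
    by simp
qed

text \<open>
  If the interiors of \<open>K\<close> and \<open>K + v\<close> were disjoint, a separating line together with its translate by
  \<open>- v\<close> would enclose \<open>K\<close> in a plank of width at most \<open>norm v\<close>.
\<close>

lemma interior_overlap_nonempty:
  assumes K: "convex_body K" and v: "norm v < min_width K"
  shows "interior (overlap K v) \<noteq> {}"
proof
  assume empty: "interior (overlap K v) = {}"
  have body: "compact K" "convex K" "interior K \<noteq> {}"
    using K by (auto simp: convex_body_def)
  have "interior K \<inter> (+) v ` interior K = {}"
    using empty by (simp add: overlap_eq_Int_translation interior_translation)
  then have "\<exists>a b. a \<noteq> 0 \<and> (\<forall>x\<in>interior K. a \<bullet> x \<le> b) \<and> (\<forall>x\<in>(+) v ` interior K. b \<le> a \<bullet> x)"
    using body by (intro separating_hyperplane_sets convex_interior convex_translation) auto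
  then obtain a b where a: "a \<noteq> 0" and ab: "\<forall>x\<in>interior K. a \<bullet> x \<le> b"
    "\<forall>x\<in>interior K. b \<le> a \<bullet> (v + x)"
    by blast
  have "closure (interior K) \<subseteq> {x. a \<bullet> x \<le> b} \<inter> {x. a \<bullet> x \<ge> b - a \<bullet> v}"
    using ab by (intro closure_minimal closed_Int closed_halfspace_le closed_halfspace_ge)
      (auto simp: inner_add_right algebra_simps)
  moreover have "K \<subseteq> closure (interior K)"
    using convex_closure_interior[OF body(2,3)] closure_subset by blast
  ultimately have sub: "K \<subseteq> {x. a \<bullet> x \<le> b} \<inter> {x. a \<bullet> x \<ge> b - a \<bullet> v}"
    by blast
  define w where "w = norm v"
  define u where "u = a /\<^sub>R norm a"
  have u: "norm u = 1"
    using a by (simp add: u_def)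
  have av: "a \<bullet> v \<le> norm a * w"
    unfolding w_def by (rule norm_cauchy_schwarz)
  have plank: "K \<subseteq> closed_plank u (b / norm a - w) w"
  proof
    fix x assume "x \<in> K"
    then have "a \<bullet> x \<le> b" "b - norm a * w \<le> a \<bullet> x"
      using sub av by fastforce+
    then show "x \<in> closed_plank u (b / norm a - w) w"
      using divide_right_mono[of "a \<bullet> x" b "norm a"]
        divide_right_mono[of "b - norm a * w" "a \<bullet> x" "norm a"] a
      by (simp add: closed_plank_def u_def divide_inverse_commute algebra_simps)
  qed
  have "v \<noteq> 0"
    using empty body by (auto simp: overlap_def)
  then have "plank_of_width (closed_plank u (b / norm a - w) w) w"
    using u by (auto simp: plank_of_width_def w_def)
  then have "min_width K \<le> w"
    unfolding min_width_def using plank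
    by (intro cInf_lower bdd_belowI[where m = 0]) (auto simp: plank_of_width_def)
  then show False
    using v by (simp add: w_def)
qed

lemma inner_real2: "x \<bullet> y = x $ 1 * y $ 1 + x $ 2 * y $ 2" for x y :: "real^2"
  by (simp add: inner_vec_def sum_2)

definition rot :: "real^2 \<Rightarrow> real^2" where
  "rot x = vector [- x $ 2, x $ 1]"

lemma rot_nth [simp]: "rot x $ 1 = - x $ 2" "rot x $ 2 = x $ 1"
  by (simp_all add: rot_def)

lemma rot_diff: "rot (x - y) = rot x - rot y"
  by (simp add: vec_eq_iff forall_2)

lemma rot_cramer: "(rot v \<bullet> d) *\<^sub>R y = (rot v \<bullet> y) *\<^sub>R d - (rot d \<bullet> y) *\<^sub>R v"
  by (simp add: vec_eq_iff forall_2 inner_real2 algebra_simps)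

text \<open>
  Here \<open>x\<close> lies above the line \<open>pq\<close>, in direction \<open>v\<close>, but beyond \<open>p\<close>. The segment from \<open>x\<close> to \<open>q\<close> then
  passes through \<open>y = p + h v\<close> with \<open>h > 0\<close>, so the chord of \<open>K\<close> from \<open>p - v\<close> to \<open>y\<close> is strictly longer
  than \<open>v\<close>. Shrinking this chord towards \<open>x\<close> until it has the length of \<open>v\<close> gives a point of
  \<open>K \<inter> (K + v)\<close> beyond \<open>p\<close>, so \<open>p\<close> cannot be extreme.
\<close>

lemma overlap_extends_beyond:
  fixes K :: "'a::euclidean_space set"
  assumes K: "convex K" and p: "p \<in> overlap K v" and q: "q \<in> K"
    and x: "x \<in> K" "x = p + s *\<^sub>R (q - p) + \<tau> *\<^sub>R v" "s < 0" "0 < \<tau>"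
    and e: "e \<bullet> v = 0" "e \<bullet> p < e \<bullet> q"
  shows "\<exists>r\<in>overlap K v. e \<bullet> r < e \<bullet> p"
proof -
  define h where "h = \<tau> / (1 - s)"
  have h: "0 < h"
    using x by (simp add: h_def)
  define y where "y = p + h *\<^sub>R v"
  have "y = (1 / (1 - s)) *\<^sub>R x + (- s / (1 - s)) *\<^sub>R q"
  proof -
    have "(1 - s) * h = \<tau>"
      using x(3) by (simp add: h_def)
    then have "(1 - s) *\<^sub>R y = (1 - s) *\<^sub>R p + \<tau> *\<^sub>R v"
      by (simp add: y_def scaleR_add_right)
    also have "\<dots> = x - s *\<^sub>R q"
      by (simp add: x(2) algebra_simps)
    finally have "(1 / (1 - s)) *\<^sub>R ((1 - s) *\<^sub>R y) = (1 / (1 - s)) *\<^sub>R (x - s *\<^sub>R q)"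
      by simp
    then have "y = (1 / (1 - s)) *\<^sub>R (x - s *\<^sub>R q)"
      using x(3) by simp
    then show ?thesis
      by (simp add: algebra_simps)
  qed
  moreover have "(1 / (1 - s)) *\<^sub>R x + (- s / (1 - s)) *\<^sub>R q \<in> K"
    using K q x(1,3) by (intro convexD) (auto simp: field_simps)
  ultimately have y: "y \<in> K"
    by simp
  define \<phi> where "\<phi> = h / (1 + h)"
  have \<phi>: "0 < \<phi>" "\<phi> < 1" "(1 - \<phi>) * (1 + h) = 1"
    using h by (auto simp: \<phi>_def field_simps)
  define r where "r = (1 - \<phi>) *\<^sub>R y + \<phi> *\<^sub>R x"
  have "r = (1 - \<phi>) *\<^sub>R (p - v) + \<phi> *\<^sub>R x + ((1 - \<phi>) * (1 + h)) *\<^sub>R v"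
    by (simp add: r_def y_def algebra_simps)
  then have "r - v = (1 - \<phi>) *\<^sub>R (p - v) + \<phi> *\<^sub>R x"
    by (simp add: \<phi>(3))
  moreover have "(1 - \<phi>) *\<^sub>R (p - v) + \<phi> *\<^sub>R x \<in> K" "r \<in> K"
    unfolding r_def using K p x(1) y \<phi> by (auto intro!: convexD simp: overlap_def)
  ultimately have "r \<in> overlap K v"
    by (simp add: overlap_def)
  moreover have "e \<bullet> r < e \<bullet> p"
  proof -
    have "e \<bullet> r - e \<bullet> p = \<phi> * s * (e \<bullet> q - e \<bullet> p)"
      using e(1) by (simp add: r_def y_def x(2) inner_add_right inner_diff_right algebra_simps)
    moreover have "\<phi> * s * (e \<bullet> q - e \<bullet> p) < 0"
      using \<phi> x(3) e(2) by (simp add: mult_pos_neg mult_neg_pos)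
    ultimately show ?thesis by linarith
  qed
  ultimately show ?thesis by blast
qed

text \<open>
  Write \<open>x = z + \<tau> v\<close> with \<open>\<tau> > 0\<close> and \<open>z\<close> on the line \<open>pq\<close>. By the previous lemma, applied at both ends,
  \<open>z\<close> lies between \<open>p\<close> and \<open>q\<close>; hence \<open>z - v \<in> K\<close>, and \<open>x - v\<close> lies between \<open>z - v\<close> and \<open>x\<close>. The vector
  \<open>rot (p - q)\<close> is the normal of the line that points in direction \<open>v\<close>.
\<close>

lemma chord_line_above:
  fixes K :: "(real^2) set"
  assumes K: "convex K" and p: "p \<in> overlap K v" and q: "q \<in> overlap K v"
    and min: "\<And>x. x \<in> overlap K v \<Longrightarrow> rot v \<bullet> p \<le> rot v \<bullet> x"
    and max: "\<And>x. x \<in> overlap K v \<Longrightarrow> rot v \<bullet> x \<le> rot v \<bullet> q"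
    and less: "rot v \<bullet> p < rot v \<bullet> q"
    and x: "x \<in> K" "rot (p - q) \<bullet> p < rot (p - q) \<bullet> x"
  shows "x - v \<in> K"
proof -
  define \<Delta> where "\<Delta> = rot v \<bullet> (q - p)"
  have \<Delta>: "0 < \<Delta>"
    using less by (simp add: \<Delta>_def inner_diff_right)
  define s where "s = rot v \<bullet> (x - p) / \<Delta>"
  define \<tau> where "\<tau> = rot (p - q) \<bullet> (x - p) / \<Delta>"
  have \<tau>: "0 < \<tau>"
    using x \<Delta> by (simp add: \<tau>_def inner_diff_right)
  have "\<Delta> *\<^sub>R (x - p) = (\<Delta> * s) *\<^sub>R (q - p) + (\<Delta> * \<tau>) *\<^sub>R v"
    using \<Delta> rot_cramer[of v "q - p" "x - p"] rot_diff[of p q] rot_diff[of q p]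
    by (simp add: s_def \<tau>_def inner_diff_left scaleR_diff_left flip: \<Delta>_def)
  also have "\<dots> = \<Delta> *\<^sub>R (s *\<^sub>R (q - p) + \<tau> *\<^sub>R v)"
    by (simp add: scaleR_add_right)
  finally have "x - p = s *\<^sub>R (q - p) + \<tau> *\<^sub>R v"
    using \<Delta> by simp
  then have x_eq: "x = p + s *\<^sub>R (q - p) + \<tau> *\<^sub>R v"
    by (simp add: algebra_simps)
  have rot_v: "rot v \<bullet> v = 0" "- rot v \<bullet> v = 0"
    by (simp_all add: inner_real2)
  have "0 \<le> s"
  proof (rule ccontr)
    assume "\<not> 0 \<le> s"
    then have "\<exists>r\<in>overlap K v. rot v \<bullet> r < rot v \<bullet> p"
      using K p q x(1) x_eq \<tau> rot_v less
      by (intro overlap_extends_beyond[where s = s and \<tau> = \<tau> and x = x and q = q]) (auto simp: overlap_def)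
    then show False
      using min by fastforce
  qed
  moreover have "s \<le> 1"
  proof (rule ccontr)
    assume "\<not> s \<le> 1"
    moreover have "x = q + (1 - s) *\<^sub>R (p - q) + \<tau> *\<^sub>R v"
      by (simp add: x_eq algebra_simps)
    ultimately have "\<exists>r\<in>overlap K v. - rot v \<bullet> r < - rot v \<bullet> q"
      using K p q x(1) \<tau> rot_v less
      by (intro overlap_extends_beyond[where s = "1 - s" and \<tau> = \<tau> and x = x and q = p]) (auto simp: overlap_def)
    then show False
      using max by fastforce
  qed
  ultimately have z: "(1 - s) *\<^sub>R (p - v) + s *\<^sub>R (q - v) \<in> K"
    using K p q by (intro convexD) (auto simp: overlap_def)
  have "(1 / (1 + \<tau>)) *\<^sub>R ((1 - s) *\<^sub>R (p - v) + s *\<^sub>R (q - v)) + (\<tau> / (1 + \<tau>)) *\<^sub>R x \<in> K"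
    by (intro convexD[OF K z x(1)]) (use \<tau> in \<open>auto simp: field_simps\<close>)
  moreover have "(1 / (1 + \<tau>)) *\<^sub>R ((1 - s) *\<^sub>R (p - v) + s *\<^sub>R (q - v)) + (\<tau> / (1 + \<tau>)) *\<^sub>R x = x - v"
  proof -
    have "(1 - s) *\<^sub>R (p - v) + s *\<^sub>R (q - v) = x - (1 + \<tau>) *\<^sub>R v"
      by (simp add: x_eq algebra_simps)
    then have "(1 / (1 + \<tau>)) *\<^sub>R ((1 - s) *\<^sub>R (p - v) + s *\<^sub>R (q - v))
        = (1 / (1 + \<tau>)) *\<^sub>R x - ((1 / (1 + \<tau>)) * (1 + \<tau>)) *\<^sub>R v"
      by (simp only: scaleR_diff_right scaleR_scaleR)
    also have "(1 / (1 + \<tau>)) * (1 + \<tau>) = 1"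
      using \<tau> by simp
    finally have "(1 / (1 + \<tau>)) *\<^sub>R ((1 - s) *\<^sub>R (p - v) + s *\<^sub>R (q - v)) + (\<tau> / (1 + \<tau>)) *\<^sub>R x
        = (1 / (1 + \<tau>) + \<tau> / (1 + \<tau>)) *\<^sub>R x - v"
      by (simp add: scaleR_add_left)
    also have "1 / (1 + \<tau>) + \<tau> / (1 + \<tau>) = 1"
      using \<tau> by (simp flip: add_divide_distrib)
    finally show ?thesis by simp
  qed
  ultimately show ?thesis by simp
qed

text \<open>
  Exchanging \<open>K\<close> with \<open>K + v\<close> and \<open>v\<close> with \<open>- v\<close> keeps the intersection and reverses all directions,
  which turns this statement into the previous one.
\<close>

lemma chord_line_below:
  fixes K :: "(real^2) set"
  assumes K: "convex K" and p: "p \<in> overlap K v" and q: "q \<in> overlap K v"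
    and min: "\<And>x. x \<in> overlap K v \<Longrightarrow> rot v \<bullet> p \<le> rot v \<bullet> x"
    and max: "\<And>x. x \<in> overlap K v \<Longrightarrow> rot v \<bullet> x \<le> rot v \<bullet> q"
    and less: "rot v \<bullet> p < rot v \<bullet> q"
    and x: "x - v \<in> K" "rot (p - q) \<bullet> x < rot (p - q) \<bullet> p"
  shows "x \<in> K"
proof -
  let ?L = "(+) v ` K"
  have L: "overlap ?L (- v) = overlap K v"
    by (force simp: overlap_def image_iff algebra_simps)
  have rot_minus: "rot (- v) = - rot v" "rot (q - p) = - rot (p - q)"
    by (simp_all add: vec_eq_iff forall_2)
  have "rot (p - q) \<bullet> (p - q) = 0"
    by (simp add: inner_real2 algebra_simps)
  then have pq: "rot (p - q) \<bullet> q = rot (p - q) \<bullet> p"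
    by (simp add: inner_diff_right)
  have "x - (- v) \<in> ?L"
  proof (rule chord_line_above[of ?L q "- v" p])
    show "x \<in> ?L"
      using x(1) by (auto simp: image_iff algebra_simps intro!: bexI[of _ "x - v"])
  qed (use K p q min max less x(2) pq in \<open>auto simp: L rot_minus convex_translation\<close>)
  then show ?thesis
    by (auto simp: image_iff algebra_simps)
qed

section \<open>The optimal plank\<close>

lemma
  fixes L :: "'a::euclidean_space set"
  assumes L: "L \<in> lmeasurable"
  shows lmeasurable_above: "L \<inter> {x. b < n \<bullet> x} \<in> lmeasurable"
    and lmeasurable_below: "L \<inter> {x. n \<bullet> x < b} \<in> lmeasurable"
    and measure_above_below_le: "measure lebesgue (L \<inter> {x. b < n \<bullet> x})
      + measure lebesgue (L \<inter> {x. n \<bullet> x < b}) \<le> measure lebesgue L"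
proof -
  show U: "L \<inter> {x. b < n \<bullet> x} \<in> lmeasurable" and D: "L \<inter> {x. n \<bullet> x < b} \<in> lmeasurable"
    using open_halfspace_lt[of n b] open_halfspace_gt[of b n]
    by (auto intro!: fmeasurable_Int_fmeasurable[OF L] borel_open)
  have "L \<inter> {x. b < n \<bullet> x} \<inter> (L \<inter> {x. n \<bullet> x < b}) = {}"
    by auto
  then have "measure lebesgue (L \<inter> {x. b < n \<bullet> x}) + measure lebesgue (L \<inter> {x. n \<bullet> x < b})
      = measure lebesgue ((L \<inter> {x. b < n \<bullet> x}) \<union> (L \<inter> {x. n \<bullet> x < b}))"
    using measure_Un3[OF U D] by simp
  also have "\<dots> \<le> measure lebesgue L"
    using U D L by (intro measure_mono_fmeasurable fmeasurableD fmeasurable.Un) auto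
  finally show "measure lebesgue (L \<inter> {x. b < n \<bullet> x})
      + measure lebesgue (L \<inter> {x. n \<bullet> x < b}) \<le> measure lebesgue L" .
qed

text \<open>
  A point of \<open>K \<inter> (K + v + h)\<close> above the line \<open>n \<bullet> x = b\<close> is in \<open>K\<close>, hence in \<open>K \<inter> (K + v)\<close>; a point below
  the line is in \<open>K + v + h\<close>, hence in \<open>h + (K \<inter> (K + v))\<close>. As \<open>h\<close> is parallel to the line, the
  two parts of \<open>K \<inter> (K + v)\<close> obtained in this way are on different sides of it.
\<close>

lemma measure_overlap_shift_along_chord_le:
  fixes K :: "(real^2) set"
  assumes K: "compact K" and n: "n \<noteq> 0" "n \<bullet> h = 0"
    and above: "\<And>x. x \<in> K \<Longrightarrow> b < n \<bullet> x \<Longrightarrow> x - v \<in> K"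
    and below: "\<And>x. x - v \<in> K \<Longrightarrow> n \<bullet> x < b \<Longrightarrow> x \<in> K"
  shows "measure lebesgue (overlap K (v + h)) \<le> measure lebesgue (overlap K v)"
proof -
  let ?U = "overlap K v \<inter> {x. b < n \<bullet> x}" and ?D = "overlap K v \<inter> {x. n \<bullet> x < b}"
  have lmeas: "overlap K x \<in> lmeasurable" for x
    using K by (simp add: lmeasurable_compact compact_overlap)
  note meas = lmeasurable_above[OF lmeas[of v], of b n] lmeasurable_below[OF lmeas[of v], of n b]
    lmeas[of "v + h"]
  have "negligible {x. n \<bullet> x = b}"
    using n(1) by (intro negligible_hyperplane) simp
  note line = negligible_imp_measurable[OF this] negligible_imp_measure0[OF this]
  have "overlap K (v + h) \<subseteq> (?U \<union> (+) h ` ?D) \<union> {x. n \<bullet> x = b}"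
  proof
    fix x assume "x \<in> overlap K (v + h)"
    then have x: "x \<in> K" "(x - h) - v \<in> K"
      by (auto simp: overlap_def algebra_simps)
    consider "b < n \<bullet> x" | "n \<bullet> x = b" | "n \<bullet> x < b" by linarith
    then show "x \<in> (?U \<union> (+) h ` ?D) \<union> {x. n \<bullet> x = b}"
    proof cases
      case 1
      then show ?thesis
        using above x by (simp add: overlap_def)
    next
      case 3
      then have "n \<bullet> (x - h) < b"
        using n by (simp add: inner_diff_right)
      then have "x - h \<in> ?D"
        using below x by (simp add: overlap_def)
      then have "x \<in> (+) h ` ?D"
        by (metis add.commute diff_add_cancel image_eqI)
      then show ?thesis by blast
    qed simp
  qed
  then have "measure lebesgue (overlap K (v + h))
      \<le> measure lebesgue ((?U \<union> (+) h ` ?D) \<union> {x. n \<bullet> x = b})"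
    using meas line by (intro measure_mono_fmeasurable fmeasurable.Un measurable_translation) auto
  also have "\<dots> \<le> measure lebesgue (?U \<union> (+) h ` ?D) + measure lebesgue {x. n \<bullet> x = b}"
    using meas line by (intro measure_Un_le fmeasurableD fmeasurable.Un measurable_translation)
  also have "\<dots> \<le> measure lebesgue ?U + measure lebesgue ((+) h ` ?D)"
    unfolding line(2) add_0_right using meas by (intro measure_Un_le fmeasurableD measurable_translation)
  also have "\<dots> = measure lebesgue ?U + measure lebesgue ?D"
    by (simp add: measure_translation)
  also have "\<dots> \<le> measure lebesgue (overlap K v)"
    by (rule measure_above_below_le[OF lmeas])
  finally show ?thesis .
qed

text \<open>
  Translating by \<open>v\<close> the part of \<open>K\<close> below the plank moves it up to the part above the plank, and the two
  together fit into \<open>K \<inter> (K + v)\<close>.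
\<close>

lemma measure_Diff_plank_le:
  fixes K :: "(real^2) set"
  assumes K: "compact K" and v: "v \<noteq> 0"
    and above: "\<And>x. x \<in> K \<Longrightarrow> b < v \<bullet> x \<Longrightarrow> x - v \<in> K"
    and below: "\<And>x. x - v \<in> K \<Longrightarrow> v \<bullet> x < b \<Longrightarrow> x \<in> K"
  shows "measure lebesgue (K - closed_plank (v /\<^sub>R norm v) (b / norm v - norm v) (norm v))
    \<le> measure lebesgue (overlap K v)" (is "measure lebesgue (K - ?P) \<le> _")
proof -
  let ?U = "overlap K v \<inter> {x. b < v \<bullet> x}" and ?D = "overlap K v \<inter> {x. v \<bullet> x < b}"
  have lmeas: "overlap K x \<in> lmeasurable" for x
    using K by (simp add: lmeasurable_compact compact_overlap)
  note meas = lmeasurable_above[OF lmeas[of v], of b v] lmeasurable_below[OF lmeas[of v], of v b]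
  have P: "?P = {x. b - v \<bullet> v \<le> v \<bullet> x} \<inter> {x. v \<bullet> x \<le> b}"
  proof -
    have ends: "b / norm v - norm v = (b - v \<bullet> v) / norm v" "(b - v \<bullet> v) / norm v + norm v = b / norm v"
      by (simp_all add: diff_divide_distrib dot_square_norm power2_eq_square)
    have "(v /\<^sub>R norm v) \<bullet> x = (v \<bullet> x) / norm v" for x
      by (simp add: divide_inverse_commute)
    then show ?thesis
      using v unfolding closed_plank_def ends by (simp add: divide_le_cancel Int_def)
  qed
  have "closed ?P"
    unfolding P by (intro closed_Int closed_halfspace_le closed_halfspace_ge)
  then have meas_K: "K - ?P \<in> sets lebesgue"
    using K by (intro sets.Diff) (auto simp: borel_closed borel_compact)
  have "K - ?P \<subseteq> ?U \<union> (+) (- v) ` ?D"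
  proof
    fix x assume x: "x \<in> K - ?P"
    then consider "b < v \<bullet> x" | "v \<bullet> x < b - v \<bullet> v"
      unfolding P by fastforce
    then show "x \<in> ?U \<union> (+) (- v) ` ?D"
    proof cases
      case 1
      then show ?thesis
        using above x by (simp add: overlap_def)
    next
      case 2
      then have "v \<bullet> (x + v) < b"
        by (simp add: inner_add_right)
      then have "x + v \<in> ?D"
        using below[of "x + v"] x by (simp add: overlap_def)
      then have "x \<in> (+) (- v) ` ?D"
        by (intro image_eqI[of _ _ "x + v"]) auto
      then show ?thesis by blast
    qed
  qed
  then have "measure lebesgue (K - ?P) \<le> measure lebesgue (?U \<union> (+) (- v) ` ?D)"
    using meas meas_K by (intro measure_mono_fmeasurable fmeasurable.Un measurable_translation) auto
  also have "\<dots> \<le> measure lebesgue ?U + measure lebesgue ((+) (- v) ` ?D)"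
    using meas by (intro measure_Un_le fmeasurableD measurable_translation)
  also have "\<dots> = measure lebesgue ?U + measure lebesgue ?D"
    by (simp only: measure_translation)
  also have "\<dots> \<le> measure lebesgue (overlap K v)"
    by (rule measure_above_below_le[OF lmeas])
  finally show ?thesis .
qed

text \<open>
  The normal of the plank is the vector \<open>v\<close> of norm \<open>W\<close> that minimises the area of \<open>K \<inter> (K + v)\<close>.
\<close>

lemma ex_plank_le_all_overlaps:
  assumes body: "convex_body K" and W: "0 < W" "W < min_width K"
  shows "\<exists>u a. norm u = 1 \<and>
    (\<forall>v. norm v = W \<longrightarrow> measure lebesgue (K - closed_plank u a W) \<le> measure lebesgue (overlap K v))"
proof -
  have K: "compact K" "convex K"
    using body by (auto simp: convex_body_def)
  define A where "A v = measure lebesgue (overlap K v)" for v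
  have "\<exists>v\<in>sphere 0 W. \<forall>y\<in>sphere 0 W. A v \<le> A y"
    unfolding A_def using W K
    by (intro continuous_attains_inf continuous_on_measure_overlap) auto
  then obtain v where v: "norm v = W" and min: "\<And>y. norm y = W \<Longrightarrow> A v \<le> A y"
    by auto
  have v0: "v \<noteq> 0"
    using v W by auto
  let ?L = "overlap K v"
  have int: "interior (overlap K y) \<noteq> {}" if "norm y = W" for y
    using interior_overlap_nonempty[OF body] that W by simp
  have L: "compact ?L" "?L \<noteq> {}"
    using K int[OF v] interior_subset by (fastforce intro: compact_overlap)+
  have "\<exists>p\<in>?L. \<forall>x\<in>?L. rot v \<bullet> p \<le> rot v \<bullet> x"
    using L by (intro continuous_attains_inf continuous_intros)
  then obtain p where p: "p \<in> ?L" "\<And>x. x \<in> ?L \<Longrightarrow> rot v \<bullet> p \<le> rot v \<bullet> x"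
    by blast
  have "\<exists>q\<in>?L. \<forall>x\<in>?L. rot v \<bullet> x \<le> rot v \<bullet> q"
    using L by (intro continuous_attains_sup continuous_intros)
  then obtain q where q: "q \<in> ?L" "\<And>x. x \<in> ?L \<Longrightarrow> rot v \<bullet> x \<le> rot v \<bullet> q"
    by blast
  have less: "rot v \<bullet> p < rot v \<bullet> q"
  proof (rule ccontr)
    assume "\<not> rot v \<bullet> p < rot v \<bullet> q"
    then have "?L \<subseteq> {x. rot v \<bullet> x = rot v \<bullet> p}"
      using p(2) q(2) by fastforce
    then have "interior ?L \<subseteq> interior {x. rot v \<bullet> x = rot v \<bullet> p}"
      by (rule interior_mono)
    moreover have "rot v \<noteq> 0"
      using v0 by (auto simp: vec_eq_iff forall_2)
    ultimately show False
      using int[OF v] by simp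
  qed
  define n where "n = rot (p - q)"
  have nv: "0 < n \<bullet> v"
    using less by (simp add: n_def inner_real2 algebra_simps)
  have n_pq: "n \<bullet> (q - p) = 0"
    by (simp add: n_def inner_real2 algebra_simps)
  have above: "x - v \<in> K" if "x \<in> K" "n \<bullet> p < n \<bullet> x" for x
    using chord_line_above[OF K(2) p(1) q(1) p(2) q(2) less] that by (simp add: n_def)
  have below: "x \<in> K" if "x - v \<in> K" "n \<bullet> x < n \<bullet> p" for x
    using chord_line_below[OF K(2) p(1) q(1) p(2) q(2) less] that by (simp add: n_def)
  define d where "d = q - p"
  have d0: "d \<noteq> 0"
    using less by (auto simp: d_def)
  have perp: "v \<bullet> d = 0"
  proof (rule ccontr)
    assume vd: "v \<bullet> d \<noteq> 0"
    \<comment> \<open>The vector \<open>v + h\<close> is the component of \<open>v\<close> orthogonal to the line through \<open>p\<close> and \<open>q\<close>.\<close>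
    define r where "r = (v \<bullet> d) / (d \<bullet> d)"
    have r: "r * (d \<bullet> d) = v \<bullet> d"
      using d0 by (simp add: r_def)
    define h where "h = - r *\<^sub>R d"
    have "(v + h) \<bullet> (v + h) = v \<bullet> v - 2 * r * (v \<bullet> d) + r * (r * (d \<bullet> d))"
      by (simp add: h_def inner_diff_left inner_diff_right inner_commute[of d v] algebra_simps)
    then have "(v + h) \<bullet> (v + h) = v \<bullet> v - r * (r * (d \<bullet> d))"
      unfolding r by simp
    moreover have "0 < r * (r * (d \<bullet> d))"
    proof -
      have "r \<noteq> 0"
        using vd r by auto
      then have "0 < r\<^sup>2 * (d \<bullet> d)"
        using d0 by simp
      then show ?thesis
        by (simp only: power2_eq_square mult.assoc)
    qed
    ultimately have "(norm (v + h))\<^sup>2 < (norm v)\<^sup>2"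
      by (simp add: power2_norm_eq_inner)
    then have vh: "norm (v + h) < W"
      using v W by (simp add: power_less_imp_less_base)
    \<comment> \<open>If \<open>v + h = 0\<close>, any vector of norm \<open>W\<close> can serve as the direction of the ray.\<close>
    define y where "y = (if v + h = 0 then v else (W / norm (v + h)) *\<^sub>R (v + h))"
    define c where "c = norm (v + h) / W"
    have y: "norm y = W" "v + h = c *\<^sub>R y"
      using v W by (auto simp: y_def c_def)
    have "A v \<le> A y"
      using min y by simp
    also have "A y < A (c *\<^sub>R y)"
      unfolding A_def using K int[OF y(1)] W y(1) vh
      by (intro measure_overlap_scale_less) (auto simp: c_def)
    also have "A (c *\<^sub>R y) \<le> A v"
      unfolding A_def y(2)[symmetric] using K nv n_pq above below
      by (intro measure_overlap_shift_along_chord_le[where n = n and b = "n \<bullet> p"])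
        (auto simp: h_def d_def)
    finally show False by simp
  qed
  have n_v: "(n \<bullet> v) *\<^sub>R v = (v \<bullet> v) *\<^sub>R n"
  proof -
    have "rot n = d"
      by (simp add: n_def d_def vec_eq_iff forall_2)
    then have "rot n \<bullet> v = 0"
      using perp by (simp add: inner_commute)
    then show ?thesis
      using rot_cramer[of n "rot v" v] by (simp add: inner_real2 vec_eq_iff forall_2 algebra_simps)
  qed
  have n_iff: "v \<bullet> p < v \<bullet> x \<longleftrightarrow> n \<bullet> p < n \<bullet> x" for x p
  proof -
    have "(n \<bullet> v) * (v \<bullet> (x - p)) = (v \<bullet> v) * (n \<bullet> (x - p))"
      using n_v by (metis inner_scaleR_left)
    then have "0 < v \<bullet> (x - p) \<longleftrightarrow> 0 < n \<bullet> (x - p)"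
      using nv v0 by (metis inner_gt_zero_iff zero_less_mult_pos zero_less_mult_iff)
    then show ?thesis
      by (simp add: inner_diff_right)
  qed
  have "measure lebesgue (K - closed_plank (v /\<^sub>R norm v) ((v \<bullet> p) / norm v - norm v) (norm v)) \<le> A v"
    unfolding A_def using K v0 above below
    by (intro measure_Diff_plank_le) (auto simp: n_iff)
  then show ?thesis
    using min v v0 unfolding A_def
    by (intro exI[of _ "v /\<^sub>R norm v"] exI[of _ "(v \<bullet> p) / norm v - norm v"]) fastforce
qed

text \<open>
  The vectors \<open>V u i\<close> have the total width \<open>V\<close> as their norm, so that \<open>w i u i = (w i / V) (V u i)\<close>: the
  translations in Bang's argument split according to the weights \<open>w i / V\<close>. If \<open>V < W\<close>, replacing \<open>V\<close> by
  \<open>W\<close> only shrinks the sets that are combined.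
\<close>

lemma measure_Diff_planks_ge:
  fixes K :: "(real^2) set" and u :: "'i \<Rightarrow> real^2"
  assumes K: "compact K" "convex K" and I: "finite I" "I \<noteq> {}"
    and u: "\<And>i. i \<in> I \<Longrightarrow> norm (u i) = 1" and w: "\<And>i. i \<in> I \<Longrightarrow> 0 < w i" "(\<Sum>i\<in>I. w i) \<le> W"
    and m: "\<And>v. norm v = W \<Longrightarrow> m \<le> measure lebesgue (overlap K v)"
  shows "m \<le> measure lebesgue (K - (\<Union>i\<in>I. open_plank (u i) (a i) (w i)))"
proof -
  define V where "V = (\<Sum>i\<in>I. w i)"
  have V: "0 < V" "V \<le> W"
    using I w by (auto simp: V_def intro: sum_pos)
  have sub: "overlap K (- (W *\<^sub>R u i)) \<subseteq> overlap K (- (V *\<^sub>R u i))" for i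
    using overlap_antimono[OF K(2), of "V / W" "- (W *\<^sub>R u i)"] V by simp
  have "m \<le> measure lebesgue (overlap K (- (V *\<^sub>R u i)))" if "i \<in> I" for i
  proof -
    have "m \<le> measure lebesgue (overlap K (- (W *\<^sub>R u i)))"
      using u[OF that] V by (intro m) simp
    also have "\<dots> \<le> measure lebesgue (overlap K (- (V *\<^sub>R u i)))"
      using sub K by (intro measure_mono_fmeasurable fmeasurableD lmeasurable_compact compact_overlap)
    finally show ?thesis .
  qed
  then have "\<exists>D. compact D \<and> convex D \<and> m \<le> measure lebesgue D \<and> (\<forall>z\<in>D. \<exists>x.
      (\<forall>i\<in>I. x i \<in> overlap K (- (V *\<^sub>R u i))) \<and> z = (\<Sum>i\<in>I. (w i / V) *\<^sub>R x i))"
    using I K V w by (intro area_quasiconcave_sum)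
      (auto intro: compact_overlap convex_overlap simp: V_def simp flip: sum_divide_distrib)
  then obtain D where D: "compact D" "m \<le> measure lebesgue D" and D_sum: "\<And>z. z \<in> D \<Longrightarrow>
      \<exists>x. (\<forall>i\<in>I. x i \<in> overlap K (- (V *\<^sub>R u i))) \<and> z = (\<Sum>i\<in>I. (w i / V) *\<^sub>R x i)"
    by blast
  have "z + (\<Sum>i\<in>S. w i *\<^sub>R u i) \<in> K" if z: "z \<in> D" and S: "S \<subseteq> I" for z S
  proof -
    obtain x where x: "\<And>i. i \<in> I \<Longrightarrow> x i \<in> overlap K (- (V *\<^sub>R u i))"
      and z_eq: "z = (\<Sum>i\<in>I. (w i / V) *\<^sub>R x i)"
      using D_sum[OF z] by blast
    have "(\<Sum>i\<in>S. w i *\<^sub>R u i) = (\<Sum>i\<in>I. (w i / V) *\<^sub>R (if i \<in> S then V *\<^sub>R u i else 0))"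
      using I S V by (intro sum.mono_neutral_cong_left) auto
    then have "z + (\<Sum>i\<in>S. w i *\<^sub>R u i)
        = (\<Sum>i\<in>I. (w i / V) *\<^sub>R (x i + (if i \<in> S then V *\<^sub>R u i else 0)))"
      by (simp add: z_eq scaleR_add_right sum.distrib)
    also have "\<dots> \<in> K"
    proof (rule convex_sum[OF I(1) K(2)])
      show "(\<Sum>i\<in>I. w i / V) = 1"
        using V by (simp add: V_def flip: sum_divide_distrib)
    qed (use x w V in \<open>auto simp: overlap_def less_imp_le\<close>)
    finally show ?thesis .
  qed
  then have "measure lebesgue D \<le> measure lebesgue (K - (\<Union>i\<in>I. {x. a i < u i \<bullet> x \<and> u i \<bullet> x < a i + w i}))"
    using I u w K D by (intro bang_translates_area) (auto intro: lmeasurable_compact)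
  then show ?thesis
    using D(2) by (simp add: open_plank_def)
qed

text \<open>
  Bang's translates may land on the boundary of a plank, so they only avoid the open planks. The
  boundary lines do not contribute to the area.
\<close>

lemma plank_sandwich:
  assumes "norm u = 1" and "P = closed_plank u a w \<or> P = open_plank u a w"
  shows "open_plank u a w \<subseteq> P" "P \<in> sets lebesgue" "open_plank u a w \<in> sets lebesgue"
    "negligible (P - open_plank u a w)"
proof -
  have "closed (closed_plank u a w)"
    using closed_Int[OF closed_halfspace_ge[of a u] closed_halfspace_le[of u "a + w"]]
    by (simp add: closed_plank_def Int_def)
  moreover have "open (open_plank u a w)"
    using open_Int[OF open_halfspace_gt[of a u] open_halfspace_lt[of u "a + w"]]
    by (simp add: open_plank_def Int_def)
  ultimately show "P \<in> sets lebesgue" "open_plank u a w \<in> sets lebesgue"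
    using assms(2) by (auto simp: borel_open borel_closed)
  show "open_plank u a w \<subseteq> P"
    using assms(2) by (auto simp: open_plank_def closed_plank_def)
  have "P - open_plank u a w \<subseteq> {x. u \<bullet> x = a} \<union> {x. u \<bullet> x = a + w}"
    using assms(2) by (auto simp: open_plank_def closed_plank_def)
  moreover have "u \<noteq> 0"
    using assms(1) by auto
  ultimately show "negligible (P - open_plank u a w)"
    using negligible_subset[OF negligible_Un[OF negligible_hyperplane negligible_hyperplane]] by blast
qed

theorem theorem12:
  fixes K :: "(real^2) set" and W :: real
  assumes "convex_body K" and "0 < W" and "W < min_width K"
  shows "\<exists>P. plank_of_width P W \<and>
    (\<forall>(n::nat) (Q :: nat \<Rightarrow> (real^2) set) (w :: nat \<Rightarrow> real).
       (\<forall>i\<in>{1..n}. plank_of_width (Q i) (w i)) \<longrightarrow> (\<Sum>i=1..n. w i) \<le> W \<longrightarrow>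
       measure lebesgue (K \<inter> (\<Union>i\<in>{1..n}. Q i)) \<le> measure lebesgue (K \<inter> P))"
proof -
  have K: "compact K" "convex K" "K \<in> lmeasurable"
    using assms(1) by (auto simp: convex_body_def lmeasurable_compact)
  obtain u a where u: "norm u = 1" and opt: "\<And>v. norm v = W \<Longrightarrow>
      measure lebesgue (K - closed_plank u a W) \<le> measure lebesgue (overlap K v)"
    using ex_plank_le_all_overlaps[OF assms] by blast
  define P where "P = closed_plank u a W"
  have P: "plank_of_width P W" "P \<in> sets lebesgue"
    using u assms(2) plank_sandwich(2)[OF u, of P a W] by (auto simp: plank_of_width_def P_def)
  have split: "measure lebesgue K = measure lebesgue (K - S) + measure lebesgue (K \<inter> S)"
    if "S \<in> sets lebesgue" for S
  proof -
    have "K - S \<in> lmeasurable" "K \<inter> S \<in> lmeasurable" "(K - S) \<inter> (K \<inter> S) = {}" "K = (K - S) \<union> (K \<inter> S)"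
      using K(3) that by (auto intro: fmeasurable_Diff fmeasurable_Int_fmeasurable)
    then show ?thesis
      using measure_Un3[of "K - S" lebesgue "K \<inter> S"] by simp
  qed
  have "measure lebesgue (K \<inter> (\<Union>i\<in>{1..n}. Q i)) \<le> measure lebesgue (K \<inter> P)"
    if Q: "\<forall>i\<in>{1..n}. plank_of_width (Q i) (w i)" and sum: "(\<Sum>i=1..n. w i) \<le> W"
    for n :: nat and Q :: "nat \<Rightarrow> (real^2) set" and w :: "nat \<Rightarrow> real"
  proof (cases "n = 0")
    case False
    have "\<forall>i\<in>{1..n}. \<exists>ub. norm (fst ub) = 1
        \<and> (Q i = closed_plank (fst ub) (snd ub) (w i) \<or> Q i = open_plank (fst ub) (snd ub) (w i))"
      using Q unfolding plank_of_width_def by (metis fst_conv snd_conv)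
    then obtain ub where ub: "\<And>i. i \<in> {1..n} \<Longrightarrow> norm (fst (ub i)) = 1"
      "\<And>i. i \<in> {1..n} \<Longrightarrow> Q i = closed_plank (fst (ub i)) (snd (ub i)) (w i)
        \<or> Q i = open_plank (fst (ub i)) (snd (ub i)) (w i)"
      by (metis (no_types, lifting) bchoice)
    define O' where "O' i = open_plank (fst (ub i)) (snd (ub i)) (w i)" for i
    note sandwich = plank_sandwich[OF ub, folded O'_def]
    let ?Q = "\<Union>i\<in>{1..n}. Q i" and ?O = "\<Union>i\<in>{1..n}. O' i" and ?N = "\<Union>i\<in>{1..n}. Q i - O' i"
    have sets: "?O \<in> sets lebesgue" "?Q \<in> sets lebesgue"
      using sandwich by (auto intro!: sets.finite_UN)
    have "measure lebesgue (K - P) \<le> measure lebesgue (K - ?O)"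
      unfolding O'_def using K Q sum ub False opt
      by (intro measure_Diff_planks_ge[where W = W]) (auto simp: P_def plank_of_width_def)
    then have "measure lebesgue (K \<inter> ?O) \<le> measure lebesgue (K \<inter> P)"
      using split[OF P(2)] split[OF sets(1)] by linarith
    moreover have "measure lebesgue (K \<inter> ?Q) \<le> measure lebesgue (K \<inter> ?O)"
    proof -
      have N: "negligible ?N"
        using sandwich(4) by (intro negligible_Union) auto
      have "measure lebesgue (K \<inter> ?Q) \<le> measure lebesgue ((K \<inter> ?O) \<union> ?N)"
        using K sets N
        by (intro measure_mono_fmeasurable fmeasurable.Un)
          (auto intro: fmeasurable_Int_fmeasurable negligible_imp_measurable)
      also have "\<dots> \<le> measure lebesgue (K \<inter> ?O) + measure lebesgue ?N"
        using K sets N by (intro measure_Un_le) (auto dest: negligible_imp_measurable)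
      finally show ?thesis
        using negligible_imp_measure0[OF N] by simp
    qed
    ultimately show ?thesis by linarith
  qed simp
  then show ?thesis
    using P by blast
qed
end
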